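(* Let $G(r,p,n)=\Sigma_n\ltimes A(r,p,n)$, let $S_1$ be a set which represents every conjugacy class of $\Sigma_n$, let $S_2=\{y_1,\dots,y_n\}$ and $S_2^{-1}=\{y_1^{-1},\dots,y_n^{-1}\}$, and let $S=S_1\cup S_2\cup S_2^{-1}$ be the generating set of $G(r,p,n)$. For two finite dimensional complex linear representations $\rho_1$ and $\rho_2$ of $G(r,p,n)$, $d(S,\rho_1)=d(S,\rho_2)$ if and only if $\rho_1\cong\rho_2$ (equivalence of representations).
   Context: Let $r,p,n$ be positive integers such that $p$ divides $r$. $\Sigma_n$ is the group of $n\times n$ permutation matrices, and $$A(r,p,n)=\{\mathrm{diag}(\omega_1,\dots,\omega_n):\ \omega_i\in\mathbb{C},\ \omega_i^r=1 \text{ for all } i,\ (\omega_1\cdots\omega_n)^{r/p}=1\}.$$ $G(r,p,n)=\Sigma_n\ltimes A(r,p,n)$, as a subgroup of $GL(n,\mathbb{C})$. The elements $y_1,\dots,y_n$ of $A(r,p,n)$ are $y_1=\mathrm{diag}(e^{2p\pi \mathrm{i}/r},1,\dots,1)$ and, for $2\le j\le n$, $y_j$ is the diagonal matrix with entry $e^{-2\pi \mathrm{i}/r}$ in position $j-1$, entry $e^{2\pi \mathrm{i}/r}$ in position $j$, and all other diagonal entries $1$ (here $\mathrm{i}=\sqrt{-1}$). For a finite list $S=\{g_1,\dots,g_m\}$ of elements of a group $G$ and a finite dimensional complex linear representation $\rho$ of $G$, the characteristic polynomial is $d(S,\rho)=\det\big(x_0I+\sum_{i=1}^m x_i\rho(g_i)\big)$,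 a polynomial in $x_0,\dots,x_m$. Equality $d(S,\rho_1)=d(S,\rho_2)$ means equality of polynomials. A set represents every conjugacy class of $\Sigma_n$ if it is a finite set of representatives of the conjugacy classes of $\Sigma_n$. *)

theory Defs
  imports
    "HOL-Algebra.Coset"
    "HOL-Combinatorics.Permutations"
    "HOL-Library.Poly_Mapping"
    Complex_Main
    "Jordan_Normal_Form.Determinant"
begin

text \<open>
  Matrix entries are indexed from \<open>0\<close>, as in \<open>Jordan_Normal_Form\<close>: the position called
  \<open>k\<close> in the usual one-based notation has index \<open>k - 1\<close>.
\<close>

definition GL :: "nat \<Rightarrow> complex mat monoid" where
  "GL n = units_of (ring_mat TYPE(complex) n ())"

definition perm_mat :: "nat \<Rightarrow> (nat \<Rightarrow> nat) \<Rightarrow> complex mat" where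
  "perm_mat n \<sigma> = mat n n (\<lambda>(i, j). if i = \<sigma> j then 1 else 0)"

definition Sigma_grp :: "nat \<Rightarrow> complex mat set" where
  "Sigma_grp n = {perm_mat n \<sigma> | \<sigma>. \<sigma> permutes {..<n}}"

definition A_grp :: "nat \<Rightarrow> nat \<Rightarrow> nat \<Rightarrow> complex mat set" where
  "A_grp r p n =
     {mat_diag n \<omega> | \<omega>. (\<forall>i<n. \<omega> i ^ r = 1) \<and> (\<Prod>i<n. \<omega> i) ^ (r div p) = 1}"

text \<open>
  The semidirect product is the internal one: the subgroup of \<open>GL n\<close> whose elements are the
  products of a permutation matrix and an element of \<open>A_grp r p n\<close>.
\<close>

definition G_grp :: "nat \<Rightarrow> nat \<Rightarrow> nat \<Rightarrow> complex mat monoid" where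
  "G_grp r p n = (GL n)\<lparr>carrier := Sigma_grp n <#>\<^bsub>GL n\<^esub> A_grp r p n\<rparr>"

text \<open>The argument \<open>j\<close> is one-based, \<open>1 \<le> j \<le> n\<close>; the index \<open>k\<close> is zero-based.\<close>

definition y_elt :: "nat \<Rightarrow> nat \<Rightarrow> nat \<Rightarrow> nat \<Rightarrow> complex mat" where
  "y_elt r p n j =
     (if j = 1
      then mat_diag n (\<lambda>k. if k = 0 then exp (2 * of_nat p * of_real pi * \<i> / of_nat r) else 1)
      else mat_diag n (\<lambda>k. if k = j - 2 then exp (- (2 * of_real pi * \<i> / of_nat r))
                           else if k = j - 1 then exp (2 * of_real pi * \<i> / of_nat r)
                           else 1))"

text \<open>
  A set meeting every conjugacy class of \<open>Sigma_grp n\<close>. It may contain several members of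
  a class; a system with exactly one representative per class is a special case.
\<close>

definition represents_conj_classes :: "nat \<Rightarrow> complex mat set \<Rightarrow> bool" where
  "represents_conj_classes n S \<longleftrightarrow>
     S \<subseteq> Sigma_grp n \<and>
     (\<forall>g\<in>Sigma_grp n. \<exists>s\<in>S. \<exists>h\<in>Sigma_grp n. g = h \<otimes>\<^bsub>GL n\<^esub> s \<otimes>\<^bsub>GL n\<^esub> inv\<^bsub>GL n\<^esub> h)"

definition complex_rep :: "('a, 'b) monoid_scheme \<Rightarrow> nat \<Rightarrow> ('a \<Rightarrow> complex mat) \<Rightarrow> bool" where
  "complex_rep G d \<rho> \<longleftrightarrow> \<rho> \<in> hom G (GL d)"

text \<open>
  Note that \<open>invertible_mat\<close> includes squareness, so equivalent representations have the
  same degree.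
\<close>

definition rep_equiv ::
    "('a, 'b) monoid_scheme \<Rightarrow> nat \<Rightarrow> ('a \<Rightarrow> complex mat) \<Rightarrow> nat \<Rightarrow> ('a \<Rightarrow> complex mat) \<Rightarrow> bool" where
  "rep_equiv G d1 \<rho>1 d2 \<rho>2 \<longleftrightarrow>
     (\<exists>P \<in> carrier_mat d2 d1. invertible_mat P \<and> (\<forall>g\<in>carrier G. P * \<rho>1 g = \<rho>2 g * P))"

text \<open>
  Polynomials over the complex numbers in the variables \<open>x\<^sub>0, x\<^sub>1, \<dots>\<close>, as finitely supported
  families of coefficients indexed by monomials (finitely supported exponent vectors).
\<close>

type_synonym cpoly = "(nat \<Rightarrow>\<^sub>0 nat) \<Rightarrow>\<^sub>0 complex"

definition cpoly_var :: "nat \<Rightarrow> cpoly" where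
  "cpoly_var i = Poly_Mapping.single (Poly_Mapping.single i 1) 1"

definition cpoly_const :: "complex \<Rightarrow> cpoly" where
  "cpoly_const c = Poly_Mapping.single 0 c"

text \<open>
  The summand for the list entry \<open>gs ! i\<close> carries the variable \<open>x\<^bsub>i+1\<^esub>\<close>. The sum of matrices
  is written entrywise.
\<close>

definition rep_charpoly :: "'a list \<Rightarrow> nat \<Rightarrow> ('a \<Rightarrow> complex mat) \<Rightarrow> cpoly" where
  "rep_charpoly gs d \<rho> =
     det (cpoly_var 0 \<cdot>\<^sub>m 1\<^sub>m d
          + mat d d (\<lambda>(a, b). \<Sum>i<length gs. cpoly_var (Suc i) * cpoly_const (\<rho> (gs ! i) $$ (a, b))))"

end

theory Submission
  imports Defs "HOL-Algebra.Multiplicative_Group" "Jordan_Normal_Form.Schur_Decomposition"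
    "Jordan_Normal_Form.Gauss_Jordan_Elimination"
begin

text \<open>
  Two different facts are combined: the polynomial determines the character, and the character
  determines the representation.

  Evaluating \<open>d(S, \<rho>)\<close> at complex points gives the characteristic polynomial of every linear
  combination \<open>M(c) = \<Sum>\<^sub>i c\<^sub>i \<rho>(g\<^sub>i)\<close>, hence, through the eigenvalues, the trace of each power
  \<open>M(c)\<^sup>k\<close>. As a polynomial in \<open>c\<close> this trace is a sum of traces of words in the \<open>g\<^sub>i\<close>, grouped by
  the number of times each letter occurs, so the trace of an individual word is in general hidden.
  It becomes visible for words with one letter \<open>s\<close> from \<open>S\<^sub>1\<close> and all other letters among the
  \<open>y\<^sub>j\<close>: because the \<open>y\<^sub>j\<close> commute and the trace is cyclic, all words with the same letters
  have the trace of the same element \<open>s w\<close>. To extract them, one differentiates in one coefficient at a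
  time; each derivative inserts one letter (\<open>trace_pow_eq_imp_trace_eq\<close>). This suffices, since
  products of the \<open>y\<^sub>j\<close> with natural exponents exhaust \<open>A(r,p,n)\<close> (\<open>A_grp_generated\<close>), and each
  element \<open>\<sigma> a'\<close> of \<open>G(r,p,n)\<close> is conjugate, by the permutation matrix that conjugates \<open>\<sigma>\<close> to its
  representative \<open>s\<close>, to an element \<open>s a\<close> with \<open>a\<close> in \<open>A(r,p,n)\<close> (\<open>conj_to_representative\<close>).

  That equal characters force equivalence is proved for an arbitrary finite group without
  decomposing anything into irreducibles. Subrepresentations are encoded as idempotent matrices
  \<open>e\<close>, \<open>f\<close> commuting with the two representations, and mutually inverse intertwiners between their
  images are built by induction on the rank \<open>tr e\<close> (\<open>intertwiner_pair_of_equal_traces\<close>). If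
  \<open>e \<noteq> 0\<close>, then \<open>\<Sum>\<^sub>g \<bar>tr(\<rho>(g) e)\<bar>\<^sup>2 > 0\<close> yields a nonzero intertwiner \<open>T\<close>. The equation
  \<open>T S T = T\<close> is linear in \<open>S\<close>, so averaging a generalized inverse of \<open>T\<close> over the group gives an
  intertwiner \<open>S\<close> that still solves it; this takes the place of Maschke's theorem. Now \<open>S T\<close> and
  \<open>T S\<close> are idempotents which can be split off from \<open>e\<close> and \<open>f\<close>, and the traces still agree on
  what remains.

  Conversely, an invertible intertwiner conjugates one matrix pencil into the other, so the two
  determinants coincide.
\<close>

section \<open>Traces and eigenvalues of complex matrices\<close>

definition mtrace :: "'a :: comm_ring_1 mat \<Rightarrow> 'a" where
  "mtrace A = (\<Sum>i<dim_row A. A $$ (i, i))"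

lemma index_mult_mat_sum:
  assumes "A \<in> carrier_mat n m" "B \<in> carrier_mat m k" "i < n" "j < k"
  shows "(A * B) $$ (i, j) = (\<Sum>l<m. A $$ (i, l) * B $$ (l, j))"
  using assms by (auto simp: scalar_prod_def lessThan_atLeast0 intro!: sum.cong)

lemma mtrace_mult_comm:
  assumes "A \<in> carrier_mat n m" "B \<in> carrier_mat m n"
  shows "mtrace (A * B) = mtrace (B * A)"
proof -
  have "mtrace (A * B) = (\<Sum>i<n. \<Sum>l<m. A $$ (i, l) * B $$ (l, i))"
    using assms by (simp add: mtrace_def index_mult_mat_sum[of A n m B n] del: index_mult_mat(1))
  also have "\<dots> = (\<Sum>l<m. \<Sum>i<n. B $$ (l, i) * A $$ (i, l))"
    by (subst sum.swap) (simp add: mult.commute)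
  also have "\<dots> = mtrace (B * A)"
    using assms by (simp add: mtrace_def index_mult_mat_sum[of B m n A m] del: index_mult_mat(1))
  finally show ?thesis .
qed

lemma mtrace_add:
  assumes "A \<in> carrier_mat n n" "B \<in> carrier_mat n n"
  shows "mtrace (A + B) = mtrace A + mtrace B"
  using assms by (simp add: mtrace_def sum.distrib)

lemma mtrace_minus:
  assumes "A \<in> carrier_mat n n" "B \<in> carrier_mat n n"
  shows "mtrace (A - B) = mtrace A - mtrace B"
  using assms by (simp add: mtrace_def sum_subtractf)

lemma mtrace_one: "mtrace (1\<^sub>m n :: 'a :: comm_ring_1 mat) = of_nat n"
  by (simp add: mtrace_def)

lemma pow_mat_add:
  assumes "A \<in> carrier_mat n n"
  shows "A ^\<^sub>m (j + k) = A ^\<^sub>m j * A ^\<^sub>m k"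
proof (induction k)
  case (Suc k)
  then show ?case
    using assms by (simp add: assoc_mult_mat[of _ n n _ n _ n] pow_carrier_mat)
qed (use assms in \<open>simp add: pow_carrier_mat\<close>)

lemma upper_triangular_mult:
  fixes A B :: "'a :: comm_ring_1 mat"
  assumes "A \<in> carrier_mat n n" "B \<in> carrier_mat n n" "upper_triangular A" "upper_triangular B"
  shows "upper_triangular (A * B)"
    and "i < n \<Longrightarrow> (A * B) $$ (i, i) = A $$ (i, i) * B $$ (i, i)"
proof -
  have zero: "A $$ (i, l) * B $$ (l, j) = 0" if "i < n" "l < n" "l < i \<or> j < l" for i l j
    using assms that by (auto simp: upper_triangular_def)
  show "upper_triangular (A * B)"
  proof (unfold upper_triangular_def, intro allI impI)
    fix i j assume "i < dim_row (A * B)" "j < i"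
    then have "i < n" "j < n" using assms by auto
    then show "(A * B) $$ (i, j) = 0"
      using \<open>j < i\<close>
      by (subst index_mult_mat_sum[OF assms(1,2)]) (auto intro!: sum.neutral zero)
  qed
  assume i: "i < n"
  then show "(A * B) $$ (i, i) = A $$ (i, i) * B $$ (i, i)"
    using zero[of i _ i] 
    by (subst index_mult_mat_sum[OF assms(1,2)])
      (auto simp: sum.remove[of "{..<n}" i] neq_iff intro!: sum.neutral)
qed

lemma upper_triangular_pow:
  fixes A :: "'a :: comm_ring_1 mat"
  assumes "A \<in> carrier_mat n n" "upper_triangular A"
  shows "upper_triangular (A ^\<^sub>m k) \<and> (\<forall>i<n. (A ^\<^sub>m k) $$ (i, i) = A $$ (i, i) ^ k)"
proof (induction k)
  case 0
  then show ?case using assms by (auto simp: upper_triangular_def)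
next
  case (Suc k)
  then show ?case
    using assms upper_triangular_mult[of "A ^\<^sub>m k" n A] by (simp add: pow_carrier_mat)
qed

text \<open>
  Both claims are read off the diagonal of a Schur triangularization of \<open>A\<close>. The power sums on the
  right depend only on the characteristic polynomial; and the second claim turns
  \<open>A\<^sup>2 = A\<close>, or a finite multiplicative order of \<open>A\<close>, into the same equation for its eigenvalues.
\<close>
lemma trace_pow_eigenvalues:
  fixes A :: "complex mat"
  assumes A: "A \<in> carrier_mat d d" and es: "char_poly A = (\<Prod>e\<leftarrow>es. [:- e, 1:])"
  shows "mtrace (A ^\<^sub>m k) = (\<Sum>e\<leftarrow>es. e ^ k)"
    and "\<And>a b e. A ^\<^sub>m a = A ^\<^sub>m b \<Longrightarrow> e \<in> set es \<Longrightarrow> e ^ a = e ^ b"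
proof -
  obtain B P Q where "schur_decomposition A es = (B, P, Q)"
    by (cases "schur_decomposition A es") auto
  from schur_decomposition[OF A es this]
  have sim: "similar_mat_wit A B P Q" and ut: "upper_triangular B" and dg: "diag_mat B = es"
    by auto
  note w = similar_mat_witD2[OF A sim]
  have Bk: "B ^\<^sub>m k \<in> carrier_mat d d" for k using w by (simp add: pow_carrier_mat)
  have tri: "(B ^\<^sub>m k) $$ (i, i) = B $$ (i, i) ^ k" if "i < d" for i k
    using upper_triangular_pow[OF w(5) ut] that by blast
  have "mtrace (A ^\<^sub>m k) = mtrace (P * (B ^\<^sub>m k * Q))"
    using similar_mat_wit_pow_id[OF sim] w Bk by (simp add: assoc_mult_mat[of _ d d _ d _ d])
  also have "\<dots> = mtrace (B ^\<^sub>m k)"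
    using w Bk by (subst mtrace_mult_comm[of _ d d]) (auto simp: assoc_mult_mat[of _ d d _ d _ d])
  also have "\<dots> = (\<Sum>i<d. B $$ (i, i) ^ k)"
    using Bk w(5) tri by (simp add: mtrace_def)
  also have "\<dots> = (\<Sum>e\<leftarrow>es. e ^ k)"
    using w(5) by (simp add: dg[symmetric] diag_mat_def comp_def interv_sum_list_conv_sum_set_nat lessThan_atLeast0)
  finally show "mtrace (A ^\<^sub>m k) = (\<Sum>e\<leftarrow>es. e ^ k)" .
  fix a b e assume ab: "A ^\<^sub>m a = A ^\<^sub>m b" and "e \<in> set es"
  then obtain i where i: "i < d" "e = B $$ (i, i)"
    using w(5) by (auto simp: dg[symmetric] diag_mat_def)
  have "B ^\<^sub>m k = Q * A ^\<^sub>m k * P" for k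
    using similar_mat_wit_pow_id[OF similar_mat_wit_sym[OF sim]] .
  then have "B ^\<^sub>m a = B ^\<^sub>m b" using ab by simp
  then show "e ^ a = e ^ b" using tri[OF i(1)] i by metis
qed

text \<open>
  The eigenvalues of an idempotent are \<open>0\<close> and \<open>1\<close>, so its trace counts the eigenvalue \<open>1\<close>. This
  makes the trace a usable measure of size: each nonzero column of \<open>P\<close> is an eigenvector for
  \<open>1\<close>, so only the zero matrix has trace \<open>0\<close>.
\<close>
lemma idempotent_trace:
  fixes P :: "complex mat"
  assumes P: "P \<in> carrier_mat d d" and idem: "P * P = P"
  obtains m :: nat where "mtrace P = of_nat m" "m = 0 \<longleftrightarrow> P = 0\<^sub>m d d"
proof -
  obtain es where es: "char_poly P = (\<Prod>e\<leftarrow>es. [:- e, 1:])"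
    using char_poly_factorized[OF P] by auto
  have pw: "P ^\<^sub>m 1 = P" "P ^\<^sub>m 2 = P" using P idem by (auto simp: numeral_2_eq_2)
  have "e = 0 \<or> e = 1" if "e \<in> set es" for e
    using trace_pow_eigenvalues(2)[OF P es, of 2 1 e] pw that by (auto simp: power2_eq_square)
  then have "(\<Sum>e\<leftarrow>es. e) = of_nat (length (filter (\<lambda>e. e = 1) es))"
    by (induction es) auto
  moreover have "mtrace P = (\<Sum>e\<leftarrow>es. e)"
    using trace_pow_eigenvalues(1)[OF P es, of 1] pw by simp
  moreover have "P = 0\<^sub>m d d" if "1 \<notin> set es"
  proof (rule ccontr)
    assume "P \<noteq> 0\<^sub>m d d"
    then obtain i j where ij: "i < d" "j < d" "P $$ (i, j) \<noteq> 0"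
      using P by (metis carrier_matD eq_matI index_zero_mat)
    have "eigenvector P (col P j) 1"
    proof -
      have "P *\<^sub>v col P j = col P j"
        using P ij idem by (metis carrier_matD(2) col_mult2)
      moreover have "col P j $ i \<noteq> 0" using P ij by simp
      then have "col P j \<noteq> 0\<^sub>v d" using ij by (metis index_zero_vec(1))
      ultimately show ?thesis using P by (auto simp: eigenvector_def)
    qed
    then have "poly (char_poly P) 1 = 0"
      using eigenvalue_root_char_poly[OF P] by (auto simp: eigenvalue_def)
    then have "1 \<in> set es"
      by (simp add: es poly_prod_list prod_list_zero_iff image_iff)
    then show False using that by simp
  qed
  moreover have "length (filter (\<lambda>e. e = 1) es) = 0 \<longleftrightarrow> 1 \<notin> set es"
    by (auto simp: filter_empty_conv)
  moreover have "mtrace P = 0" if "P = 0\<^sub>m d d" using that by (simp add: mtrace_def)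
  ultimately show thesis using that by (metis of_nat_eq_0_iff)
qed

text \<open>
  For a matrix \<open>R\<close> in reduced row echelon form, the matrix \<open>R'\<close> that sends the \<open>i\<close>-th unit vector
  to the one at the \<open>i\<close>-th pivot column satisfies \<open>R R' R = R\<close>. Row operations carry this to \<open>T\<close>.
\<close>
lemma generalized_inverse_exists:
  fixes T :: "'a :: field mat"
  assumes T: "T \<in> carrier_mat m n"
  obtains S where "S \<in> carrier_mat n m" "T * S * T = T"
proof -
  define R where "R = gauss_jordan_single T"
  note gj = gauss_jordan_single[OF T R_def[symmetric]]
  obtain P Q where PQ: "R = P * T" "P \<in> carrier_mat m m" "Q \<in> carrier_mat m m"
    "P * Q = 1\<^sub>m m" "Q * P = 1\<^sub>m m" using gj(4) by blast
  have R: "R \<in> carrier_mat m n" using gj(2) .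
  obtain f where "pivot_fun R f n" using gj(3) R by (auto simp: row_echelon_form_def)
  note pf = pivot_funD[OF _ this, of m]
  (* a zero row i has f i = n, so the i-th column of R' vanishes *)
  define R' where "R' = mat n m (\<lambda>(j, i). if j = f i then 1 else 0 :: 'a)"
  have R': "R' \<in> carrier_mat n m" by (simp add: R'_def)
  have RR': "(R * R') $$ (i, k) = (if i = k \<and> f k < n then 1 else 0)" if "i < m" "k < m" for i k
  proof -
    have "(R * R') $$ (i, k) = (\<Sum>l<n. R $$ (i, l) * (if l = f k then 1 else 0))"
      using that by (subst index_mult_mat_sum[OF R R']) (auto simp: R'_def)
    also have "\<dots> = (if f k < n then R $$ (i, f k) else 0)"
      by (simp add: if_distrib cong: if_cong)
    also have "\<dots> = (if i = k \<and> f k < n then 1 else 0)"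
      using pf(4)[of k] pf(5)[of k i] that R by auto
    finally show ?thesis .
  qed
  have "R * R' * R = R"
  proof (rule eq_matI)
    fix i j assume "i < dim_row R" "j < dim_col R"
    then have ij: "i < m" "j < n" using R by auto
    have "(R * R' * R) $$ (i, j) = (\<Sum>k<m. (if i = k \<and> f k < n then 1 else 0) * R $$ (k, j))"
      using ij RR' R' by (subst index_mult_mat_sum[OF mult_carrier_mat[OF R R'] R]) auto
    also have "\<dots> = (\<Sum>k<m. if k = i then (if f i < n then R $$ (i, j) else 0) else 0)"
      by (intro sum.cong) auto
    also have "\<dots> = (if f i < n then R $$ (i, j) else 0)"
      using ij by simp
    also have "\<dots> = R $$ (i, j)"
      using pf(1)[of i] pf(2)[of i j] ij R by auto
    finally show "(R * R' * R) $$ (i, j) = R $$ (i, j)" .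
  qed (use R R' in auto)
  then have "Q * (R * R' * R) = Q * R" by simp
  moreover have QR: "Q * R = T" using PQ T by (simp add: assoc_mult_mat[symmetric, of _ m m _ m _ n])
  ultimately have "T * (R' * P) * T = T"
    using R R' PQ T by (simp add: assoc_mult_mat[of _ m m _ m _ n] assoc_mult_mat[of _ m n _ m _ n]
        assoc_mult_mat[of _ m m _ n _ m] assoc_mult_mat[of _ m n _ m _ m] assoc_mult_mat[of _ n m _ m _ n] 
        assoc_mult_mat[of _ m m _ n _ n] flip: assoc_mult_mat[of Q m m P m _ n])
  then show thesis using that[of "R' * P"] R' PQ by simp
qed

text \<open>The size \<open>d\<close> is an argument so that the empty sum is a matrix of the right size.\<close>
definition msum :: "nat \<Rightarrow> ('b \<Rightarrow> 'a :: comm_ring_1 mat) \<Rightarrow> 'b set \<Rightarrow> 'a mat" where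
  "msum d f I = mat d d (\<lambda>(i, j). \<Sum>x\<in>I. f x $$ (i, j))"

lemma msum_carrier[simp]: "msum d f I \<in> carrier_mat d d"
  "dim_row (msum d f I) = d" "dim_col (msum d f I) = d"
  by (auto simp: msum_def)

lemma msum_cong: "(\<And>x. x \<in> I \<Longrightarrow> f x = g x) \<Longrightarrow> msum d f I = msum d g I"
  by (auto simp: msum_def intro!: eq_matI sum.cong)

lemma mult_msum:
  assumes "A \<in> carrier_mat d d" "\<And>x. x \<in> I \<Longrightarrow> f x \<in> carrier_mat d d"
  shows "A * msum d f I = msum d (\<lambda>x. A * f x) I"
proof (rule eq_matI)
  fix i j assume "i < dim_row (msum d (\<lambda>x. A * f x) I)" "j < dim_col (msum d (\<lambda>x. A * f x) I)"
  then have ij: "i < d" "j < d" by auto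
  have "(A * msum d f I) $$ (i, j) = (\<Sum>l<d. A $$ (i, l) * (\<Sum>x\<in>I. f x $$ (l, j)))"
    using ij by (subst index_mult_mat_sum[OF assms(1)]) (auto simp: msum_def)
  also have "\<dots> = (\<Sum>x\<in>I. \<Sum>l<d. A $$ (i, l) * f x $$ (l, j))"
    by (simp add: sum_distrib_left sum.swap[of _ I])
  also have "\<dots> = (\<Sum>x\<in>I. (A * f x) $$ (i, j))"
    using ij assms by (intro sum.cong refl) (simp add: index_mult_mat_sum[of A d d _ d] del: index_mult_mat(1))
  finally show "(A * msum d f I) $$ (i, j) = msum d (\<lambda>x. A * f x) I $$ (i, j)"
    using ij by (simp add: msum_def)
qed (use assms in auto)

lemma msum_mult:
  assumes "A \<in> carrier_mat d d" "\<And>x. x \<in> I \<Longrightarrow> f x \<in> carrier_mat d d"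
  shows "msum d f I * A = msum d (\<lambda>x. f x * A) I"
proof (rule eq_matI)
  fix i j assume "i < dim_row (msum d (\<lambda>x. f x * A) I)" "j < dim_col (msum d (\<lambda>x. f x * A) I)"
  then have ij: "i < d" "j < d" by auto
  have "(msum d f I * A) $$ (i, j) = (\<Sum>l<d. (\<Sum>x\<in>I. f x $$ (i, l)) * A $$ (l, j))"
    using ij by (subst index_mult_mat_sum[OF _ assms(1)]) (auto simp: msum_def)
  also have "\<dots> = (\<Sum>x\<in>I. \<Sum>l<d. f x $$ (i, l) * A $$ (l, j))"
    by (simp add: sum_distrib_right sum.swap[of _ I])
  also have "\<dots> = (\<Sum>x\<in>I. (f x * A) $$ (i, j))"
    using ij assms by (intro sum.cong refl) (simp add: index_mult_mat_sum[of _ d d A d] del: index_mult_mat(1))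
  finally show "(msum d f I * A) $$ (i, j) = msum d (\<lambda>x. f x * A) I $$ (i, j)"
    using ij by (simp add: msum_def)
qed (use assms in auto)

lemma msum_reindex:
  assumes "bij_betw h I J"
  shows "msum d (\<lambda>x. f (h x)) I = msum d f J"
  using assms by (auto simp: msum_def intro!: eq_matI sum.reindex_bij_betw)

lemma msum_const: 
  assumes "A \<in> carrier_mat d d"
  shows "msum d (\<lambda>_. A) I = of_nat (card I) \<cdot>\<^sub>m A"
  using assms by (auto simp: msum_def intro!: eq_matI)

section \<open>Representations of a finite group with equal characters\<close>

definition mat_rep :: "('a, 'b) monoid_scheme \<Rightarrow> nat \<Rightarrow> ('a \<Rightarrow> complex mat) \<Rightarrow> bool" where
  "mat_rep G d \<rho> \<longleftrightarrow>
     \<rho> ` carrier G \<subseteq> carrier_mat d d \<and> \<rho> \<one>\<^bsub>G\<^esub> = 1\<^sub>m d \<and>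
     (\<forall>g\<in>carrier G. \<forall>h\<in>carrier G. \<rho> (g \<otimes>\<^bsub>G\<^esub> h) = \<rho> g * \<rho> h)"

definition intertwines ::
    "('a, 'b) monoid_scheme \<Rightarrow> nat \<Rightarrow> ('a \<Rightarrow> complex mat) \<Rightarrow> ('a \<Rightarrow> complex mat) \<Rightarrow> complex mat \<Rightarrow> bool" where
  "intertwines G d \<rho> \<sigma> T \<longleftrightarrow> T \<in> carrier_mat d d \<and> (\<forall>g\<in>carrier G. T * \<rho> g = \<sigma> g * T)"

text \<open>
  Averaging over the group, up to the factor \<open>1 / |G|\<close>: this makes an intertwiner out of any matrix.
\<close>
definition conj_sum ::
    "('a, 'b) monoid_scheme \<Rightarrow> nat \<Rightarrow> ('a \<Rightarrow> complex mat) \<Rightarrow> ('a \<Rightarrow> complex mat) \<Rightarrow> complex mat \<Rightarrow> complex mat" where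
  "conj_sum G d \<rho> \<sigma> M = msum d (\<lambda>g. \<sigma> g * (M * \<rho> (inv\<^bsub>G\<^esub> g))) (carrier G)"

locale two_reps = group G for G :: "('a, 'b) monoid_scheme" (structure) +
  fixes d :: nat and \<rho> \<sigma> :: "'a \<Rightarrow> complex mat"
  assumes finite_carrier: "finite (carrier G)"
    and rep1: "mat_rep G d \<rho>" and rep2: "mat_rep G d \<sigma>"
begin

lemmas mat_simps = assoc_mult_mat[of _ d d _ d _ d]
  add_mult_distrib_mat[of _ d d _ _ d] mult_add_distrib_mat[of _ d d _ d]
  minus_mult_distrib_mat[of _ d d _ _ d] mult_minus_distrib_mat[of _ d d _ d]
  mult_carrier_mat[of _ d d _ d] minus_carrier_mat[of _ d d]

lemma rho_carrier[simp]: "g \<in> carrier G \<Longrightarrow> \<rho> g \<in> carrier_mat d d"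
  and sigma_carrier[simp]: "g \<in> carrier G \<Longrightarrow> \<sigma> g \<in> carrier_mat d d"
  and rho_one: "\<rho> \<one> = 1\<^sub>m d" and sigma_one: "\<sigma> \<one> = 1\<^sub>m d"
  and rho_mult: "g \<in> carrier G \<Longrightarrow> h \<in> carrier G \<Longrightarrow> \<rho> (g \<otimes> h) = \<rho> g * \<rho> h"
  and sigma_mult: "g \<in> carrier G \<Longrightarrow> h \<in> carrier G \<Longrightarrow> \<sigma> (g \<otimes> h) = \<sigma> g * \<sigma> h"
  using rep1 rep2 by (auto simp: mat_rep_def)

lemma swapped: "two_reps G d \<sigma> \<rho>"
  by unfold_locales (rule finite_carrier rep1 rep2)+

lemma conj_sum_intertwines:
  assumes M: "M \<in> carrier_mat d d"
  shows "intertwines G d \<rho> \<sigma> (conj_sum G d \<rho> \<sigma> M)"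
  unfolding intertwines_def
proof (intro conjI ballI)
  show "conj_sum G d \<rho> \<sigma> M \<in> carrier_mat d d" by (simp add: conj_sum_def)
  fix h assume h: "h \<in> carrier G"
  define F where "F k = \<sigma> k * (M * \<rho> (inv k \<otimes> h))" for k
  have bij: "bij_betw (\<lambda>g. h \<otimes> g) (carrier G) (carrier G)"
    by (rule bij_betw_byWitness[where f' = "\<lambda>g. inv h \<otimes> g"])
      (use h in \<open>auto simp: m_assoc[symmetric]\<close>)
  have "conj_sum G d \<rho> \<sigma> M * \<rho> h = msum d F (carrier G)"
    unfolding conj_sum_def F_def using h M
    by (subst msum_mult) (auto simp: mat_simps rho_mult intro!: msum_cong)
  also have "\<dots> = msum d (\<lambda>g. F (h \<otimes> g)) (carrier G)"
    using msum_reindex[OF bij, of d F] by simp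
  also have "\<dots> = msum d (\<lambda>g. \<sigma> h * (\<sigma> g * (M * \<rho> (inv g)))) (carrier G)"
  proof (rule msum_cong)
    fix g assume g: "g \<in> carrier G"
    have "inv (h \<otimes> g) \<otimes> h = inv g" using g h by (simp add: inv_mult_group m_assoc)
    then show "F (h \<otimes> g) = \<sigma> h * (\<sigma> g * (M * \<rho> (inv g)))"
      using g h M by (simp add: F_def sigma_mult mat_simps)
  qed
  also have "\<dots> = \<sigma> h * conj_sum G d \<rho> \<sigma> M"
    unfolding conj_sum_def using h M by (subst mult_msum) (auto simp: mat_simps)
  finally show "conj_sum G d \<rho> \<sigma> M * \<rho> h = \<sigma> h * conj_sum G d \<rho> \<sigma> M" .
qed

text \<open>
  Any generalized inverse \<open>S\<^sub>0\<close> of \<open>T\<close> can be averaged: since \<open>T\<close> intertwines, each summand of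
  \<open>T (\<Sum>\<^sub>g \<rho>(g) S\<^sub>0 \<sigma>(g\<inverse>)) T\<close> equals \<open>T\<close>.
\<close>
lemma intertwining_generalized_inverse:
  assumes T: "intertwines G d \<rho> \<sigma> T"
  obtains S where "intertwines G d \<sigma> \<rho> S" "T * S * T = T"
proof -
  have Tc: "T \<in> carrier_mat d d" and Ti: "\<And>g. g \<in> carrier G \<Longrightarrow> T * \<rho> g = \<sigma> g * T"
    using T by (auto simp: intertwines_def)
  obtain S0 where S0: "S0 \<in> carrier_mat d d" "T * S0 * T = T"
    using generalized_inverse_exists[OF Tc] .
  define C where "C = conj_sum G d \<sigma> \<rho> S0"
  have C: "intertwines G d \<sigma> \<rho> C"
    unfolding C_def by (rule two_reps.conj_sum_intertwines[OF swapped S0(1)])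
  then have Cc: "C \<in> carrier_mat d d" and Ci: "\<And>g. g \<in> carrier G \<Longrightarrow> C * \<sigma> g = \<rho> g * C"
    by (auto simp: intertwines_def)
  have "T * C * T = msum d (\<lambda>g. T * (\<rho> g * (S0 * \<sigma> (inv g))) * T) (carrier G)"
    unfolding C_def conj_sum_def using Tc S0
    by (subst mult_msum, simp_all add: mat_simps, subst msum_mult) (auto simp: mat_simps intro!: msum_cong)
  also have "\<dots> = msum d (\<lambda>g. T) (carrier G)"
  proof (rule msum_cong)
    fix g assume g: "g \<in> carrier G"
    have "T * (\<rho> g * (S0 * \<sigma> (inv g))) * T = (T * \<rho> g) * S0 * (\<sigma> (inv g) * T)"
      using g Tc S0(1) by (simp add: mat_simps)
    also have "\<dots> = (\<sigma> g * T) * S0 * (T * \<rho> (inv g))"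
      using g by (simp add: Ti)
    also have "\<dots> = \<sigma> g * (T * S0 * T) * \<rho> (inv g)"
      using g Tc S0(1) by (simp add: mat_simps)
    also have "\<dots> = (T * \<rho> g) * \<rho> (inv g)" using g by (simp add: S0(2) Ti)
    also have "\<dots> = T" using g Tc by (simp add: mat_simps flip: rho_mult) (simp add: rho_one)
    finally show "T * (\<rho> g * (S0 * \<sigma> (inv g))) * T = T" .
  qed
  finally have TCT: "T * C * T = of_nat (Coset.order G) \<cdot>\<^sub>m T"
    using Tc by (simp add: msum_const Coset.order_def)
  define S where "S = (1 / of_nat (Coset.order G)) \<cdot>\<^sub>m C"
  have "Coset.order G > 0" using finite_carrier order_gt_0_iff_finite by blast
  then have "T * S * T = T"
    using TCT Tc Cc by (auto simp: S_def mult_smult_distrib[of _ d d] mult_smult_assoc_mat[of _ d d] intro!: eq_matI)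
  moreover have "intertwines G d \<sigma> \<rho> S"
    using Cc Ci by (auto simp: intertwines_def S_def mult_smult_distrib[of _ d d _ d] mult_smult_assoc_mat[of _ d d _ d])
  ultimately show thesis using that by blast
qed

text \<open>
  On the image of \<open>e\<close> the matrix \<open>\<rho>(g)\<close> has finite order, so the nonzero eigenvalues of
  \<open>X = \<rho>(g) e\<close> lie on the unit circle, where inversion is complex conjugation.
\<close>
lemma trace_inv_cnj:
  assumes e: "e \<in> carrier_mat d d" "e * e = e" and comm: "\<And>g. g \<in> carrier G \<Longrightarrow> e * \<rho> g = \<rho> g * e"
    and g: "g \<in> carrier G"
  shows "mtrace (\<rho> (inv g) * e) = cnj (mtrace (\<rho> g * e))"
proof -
  define X where "X = \<rho> g * e"
  have X: "X \<in> carrier_mat d d" using e g by (simp add: X_def mat_simps)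
  have pw: "X ^\<^sub>m (Suc k) = \<rho> (g [^] Suc k) * e" for k
  proof (induction k)
    case 0
    then show ?case using X g by (simp add: X_def)
  next
    case (Suc k)
    have gk: "g [^] Suc k \<in> carrier G" using g by blast
    have "X ^\<^sub>m Suc (Suc k) = \<rho> (g [^] Suc k) * e * (\<rho> g * e)" using Suc.IH by (simp add: X_def)
    also have "\<dots> = \<rho> (g [^] Suc k) * ((e * \<rho> g) * e)" 
      using g gk e(1) by (simp add: mat_simps del: nat_pow_Suc)
    also have "\<dots> = \<rho> (g [^] Suc k) * \<rho> g * e"
      using g gk e by (simp add: mat_simps comm del: nat_pow_Suc)
    also have "\<rho> (g [^] Suc k) * \<rho> g = \<rho> (g [^] Suc (Suc k))"
      using g gk by (simp add: rho_mult[symmetric])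
    finally show ?case .
  qed
  (* The exponent 2 |G| - 1 represents the inverse of g and is positive even for |G| = 1;
     X to the power 0 would be the identity instead of e. *)
  define N where "N = Coset.order G"
  have N: "N > 0" using finite_carrier order_gt_0_iff_finite N_def by blast
  have gN: "g [^] (N + N) = \<one>"
    using g group.pow_order_eq_1[OF is_group] by (simp add: N_def nat_pow_mult[symmetric])
  define m where "m = N + N - 2"
  have m: "N + N = Suc (Suc m)" using N by (simp add: m_def)
  have "g [^] (Suc m) \<otimes> g = \<one>" using gN m by simp
  then have inv: "g [^] (Suc m) = inv g" using g by (metis inv_equality inv_inv inv_closed nat_pow_closed inv_comm)
  have Xinv: "X ^\<^sub>m (Suc m) = \<rho> (inv g) * e" using pw[of m] inv by simp
  have "X ^\<^sub>m (Suc (Suc (Suc m))) = X ^\<^sub>m 1"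
    using pw[of "Suc (Suc m)"] gN m X g by (simp add: X_def)
  obtain es where es: "char_poly X = (\<Prod>e\<leftarrow>es. [:- e, 1:])"
    using char_poly_factorized[OF X] by auto
  have ev: "z ^ Suc m = cnj z" if "z \<in> set es" for z
  proof (cases "z = 0")
    case False
    have "z ^ Suc (Suc (Suc m)) = z ^ 1"
      using trace_pow_eigenvalues(2)[OF X es] \<open>X ^\<^sub>m (Suc (Suc (Suc m))) = X ^\<^sub>m 1\<close> that by blast
    then have z1: "z ^ Suc (Suc m) = 1" using False by simp
    then have "norm z ^ Suc (Suc m) = 1" by (metis norm_one norm_power)
    then have "norm z = 1" by (metis norm_ge_zero power_eq_1_iff zero_less_Suc power_eq_imp_eq_base power_one zero_le_one)
    then have "z * cnj z = 1" by (simp add: complex_norm_square[symmetric])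
    moreover have "z * z ^ Suc m = 1" using z1 by simp
    ultimately show ?thesis using False by (metis mult_left_cancel)
  qed simp
  have "mtrace (\<rho> (inv g) * e) = (\<Sum>z\<leftarrow>es. z ^ Suc m)"
    using trace_pow_eigenvalues(1)[OF X es, of "Suc m"] Xinv by simp
  also have "\<dots> = (\<Sum>z\<leftarrow>es. cnj z)" using ev by (intro arg_cong[where f = sum_list] map_cong refl) auto
  also have "\<dots> = cnj (\<Sum>z\<leftarrow>es. z ^ 1)" by (induction es) auto
  also have "\<dots> = cnj (mtrace X)" using trace_pow_eigenvalues(1)[OF X es, of 1] X by simp
  finally show ?thesis by (simp add: X_def)
qed

text \<open>
  Average the matrices \<open>f E e\<close> over the group, where \<open>E\<close> runs through the matrix units \<open>E a b\<close>. The
  \<open>(a, b)\<close> entry of the average of \<open>f (E a b) e\<close> is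
  \<open>\<Sum>\<^sub>g (\<sigma>(g) f)\<^sub>a\<^sub>a (\<rho>(g\<inverse>) e)\<^sub>b\<^sub>b\<close>. If all these averages vanished, summing over \<open>a\<close> and \<open>b\<close> would
  give \<open>\<Sum>\<^sub>g \<bar>tr(\<rho>(g) e)\<bar>\<^sup>2 = 0\<close>, although the summand of the identity is \<open>(tr e)\<^sup>2\<close>.
\<close>
lemma nonzero_intertwiner:
  assumes e: "e \<in> carrier_mat d d" "e * e = e" and f: "f \<in> carrier_mat d d" "f * f = f"
    and ce: "\<And>g. g \<in> carrier G \<Longrightarrow> e * \<rho> g = \<rho> g * e"
    and cf: "\<And>g. g \<in> carrier G \<Longrightarrow> f * \<sigma> g = \<sigma> g * f"
    and tr: "\<And>g. g \<in> carrier G \<Longrightarrow> mtrace (\<rho> g * e) = mtrace (\<sigma> g * f)"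
    and "e \<noteq> 0\<^sub>m d d"
  obtains T where "intertwines G d \<rho> \<sigma> T" "T \<noteq> 0\<^sub>m d d" "T * e = T" "f * T = T"
proof -
  define E :: "nat \<Rightarrow> nat \<Rightarrow> complex mat" where "E a b = mat d d (\<lambda>(i, j). if i = a \<and> j = b then 1 else 0)" for a b
  define T where "T a b = conj_sum G d \<rho> \<sigma> (f * (E a b * e))" for a b
  have E: "E a b \<in> carrier_mat d d" for a b by (simp add: E_def)
  have entry: "T a b $$ (a, b) = (\<Sum>g\<in>carrier G. (\<sigma> g * f) $$ (a, a) * (\<rho> (inv g) * e) $$ (b, b))"
    if ab: "a < d" "b < d" for a b
  proof -
    have "(\<sigma> g * (f * (E a b * e) * \<rho> (inv g))) $$ (a, b) = (\<sigma> g * f) $$ (a, a) * (\<rho> (inv g) * e) $$ (b, b)"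
      if g: "g \<in> carrier G" for g
    proof -
      have A: "\<sigma> g * f \<in> carrier_mat d d" and B: "\<rho> (inv g) * e \<in> carrier_mat d d"
        using g e f by (auto simp: mat_simps)
      have "\<sigma> g * (f * (E a b * e) * \<rho> (inv g)) = (\<sigma> g * f) * (E a b * (\<rho> (inv g) * e))"
        using g e f E by (simp add: mat_simps ce)
      also have "\<dots> $$ (a, b) = (\<Sum>l<d. (\<sigma> g * f) $$ (a, l) * (\<Sum>k<d. E a b $$ (l, k) * (\<rho> (inv g) * e) $$ (k, b)))"
        using ab A B E by (simp add: index_mult_mat_sum[of _ d d _ d] mat_simps del: index_mult_mat(1))
      also have "\<dots> = (\<Sum>l<d. if l = a then (\<sigma> g * f) $$ (a, a) * (\<rho> (inv g) * e) $$ (b, b) else 0)"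
      proof (intro sum.cong refl)
        fix l assume "l \<in> {..<d}"
        then have "(\<Sum>k<d. E a b $$ (l, k) * (\<rho> (inv g) * e) $$ (k, b)) =
            (\<Sum>k<d. if k = b then (if l = a then (\<rho> (inv g) * e) $$ (b, b) else 0) else 0)"
          by (intro sum.cong) (auto simp: E_def)
        then show "(\<sigma> g * f) $$ (a, l) * (\<Sum>k<d. E a b $$ (l, k) * (\<rho> (inv g) * e) $$ (k, b)) =
            (if l = a then (\<sigma> g * f) $$ (a, a) * (\<rho> (inv g) * e) $$ (b, b) else 0)"
          using ab by simp
      qed
      finally show ?thesis using ab by simp
    qed
    then show ?thesis using ab by (simp add: T_def conj_sum_def msum_def)
  qed
  have "\<exists>a<d. \<exists>b<d. T a b \<noteq> 0\<^sub>m d d"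
  proof (rule ccontr)
    assume "\<not> (\<exists>a<d. \<exists>b<d. T a b \<noteq> 0\<^sub>m d d)"
    then have "(\<Sum>a<d. \<Sum>b<d. T a b $$ (a, b)) = 0" by simp
    moreover have "(\<Sum>a<d. \<Sum>b<d. T a b $$ (a, b)) =
       (\<Sum>g\<in>carrier G. \<Sum>a<d. \<Sum>b<d. (\<sigma> g * f) $$ (a, a) * (\<rho> (inv g) * e) $$ (b, b))"
      by (simp add: entry sum.swap[of _ "carrier G"])
    also have "\<dots> = (\<Sum>g\<in>carrier G. mtrace (\<sigma> g * f) * mtrace (\<rho> (inv g) * e))"
    proof (intro sum.cong refl)
      fix g assume g: "g \<in> carrier G"
      have "dim_row (\<sigma> g * f) = d" "dim_row (\<rho> (inv g) * e) = d"
        using g carrier_matD(1)[OF sigma_carrier] carrier_matD(1)[OF rho_carrier] by simp_all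
      then show "(\<Sum>a<d. \<Sum>b<d. (\<sigma> g * f) $$ (a, a) * (\<rho> (inv g) * e) $$ (b, b)) =
          mtrace (\<sigma> g * f) * mtrace (\<rho> (inv g) * e)"
        unfolding mtrace_def sum_product by (simp only:)
    qed
    also have "\<dots> = (\<Sum>g\<in>carrier G. of_real ((cmod (mtrace (\<rho> g * e)))\<^sup>2))"
      using e by (intro sum.cong refl) (simp add: tr[symmetric] trace_inv_cnj ce complex_norm_square del: of_real_power)
    also have "\<dots> = of_real (\<Sum>g\<in>carrier G. (cmod (mtrace (\<rho> g * e)))\<^sup>2)" by simp
    ultimately have "(\<Sum>g\<in>carrier G. (cmod (mtrace (\<rho> g * e)))\<^sup>2) = 0"
      by (metis of_real_eq_0_iff)
    then have "cmod (mtrace (\<rho> \<one> * e)) ^ 2 = 0"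
      using finite_carrier by (subst (asm) sum_nonneg_eq_0_iff) auto
    then have "mtrace e = 0" using e by (simp add: rho_one)
    then show False using idempotent_trace[OF e] \<open>e \<noteq> 0\<^sub>m d d\<close> by (metis of_nat_eq_0_iff)
  qed
  then obtain a b where ab: "T a b \<noteq> 0\<^sub>m d d" by blast
  have "f * T a b = T a b"
  proof -
    have "f * (\<sigma> g * (f * (E a b * e) * \<rho> (inv g))) = \<sigma> g * (f * (E a b * e) * \<rho> (inv g))"
      if g: "g \<in> carrier G" for g
    proof -
      have "f * (\<sigma> g * (f * (E a b * e) * \<rho> (inv g))) = (f * \<sigma> g) * f * (E a b * e * \<rho> (inv g))"
        using g e(1) f(1) E by (simp add: mat_simps)
      also have "\<dots> = \<sigma> g * (f * f) * (E a b * e * \<rho> (inv g))"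
        using g e(1) f(1) E by (simp add: mat_simps cf)
      finally show ?thesis using g e(1) f E by (simp add: mat_simps)
    qed
    then show ?thesis unfolding T_def conj_sum_def using f(1) e(1) E
      by (subst mult_msum) (auto simp: mat_simps intro!: msum_cong)
  qed
  moreover have "T a b * e = T a b"
  proof -
    have "\<sigma> g * (f * (E a b * e) * \<rho> (inv g)) * e = \<sigma> g * (f * (E a b * e) * \<rho> (inv g))"
      if g: "g \<in> carrier G" for g
    proof -
      have "\<sigma> g * (f * (E a b * e) * \<rho> (inv g)) * e = \<sigma> g * f * E a b * (e * (\<rho> (inv g) * e))"
        using g e(1) f(1) E by (simp add: mat_simps)
      also have "\<dots> = \<sigma> g * f * E a b * (e * (e * \<rho> (inv g)))"
        using g by (simp add: ce)
      also have "\<dots> = \<sigma> g * f * E a b * ((e * e) * \<rho> (inv g))"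
        using g e(1) f(1) E by (simp add: mat_simps)
      finally show ?thesis using g e f(1) E by (simp add: mat_simps)
    qed
    then show ?thesis unfolding T_def conj_sum_def using f(1) e(1) E
      by (subst msum_mult) (auto simp: mat_simps intro!: msum_cong)
  qed
  moreover have "intertwines G d \<rho> \<sigma> (T a b)"
    unfolding T_def using e f E by (intro conj_sum_intertwines) (auto simp: mat_simps)
  ultimately show thesis using that ab by blast
qed

text \<open>
  Isomorphism of the images of \<open>e\<close> and \<open>f\<close> as representations, witnessed by \<open>U\<close> and \<open>W\<close>. In the
  induction step a partial isomorphism \<open>T\<close> with inverse \<open>S\<close> is split off; the four absorption
  equations \<open>U e = U\<close>, \<open>f U = U\<close>, \<open>W f = W\<close>, \<open>e W = W\<close> make the cross terms with the remaining pair
  vanish.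
\<close>
lemma intertwiner_pair_of_equal_traces:
  assumes "mtrace e = of_nat m"
    and "e \<in> carrier_mat d d" "e * e = e" "f \<in> carrier_mat d d" "f * f = f"
    and "\<And>g. g \<in> carrier G \<Longrightarrow> e * \<rho> g = \<rho> g * e"
    and "\<And>g. g \<in> carrier G \<Longrightarrow> f * \<sigma> g = \<sigma> g * f"
    and "\<And>g. g \<in> carrier G \<Longrightarrow> mtrace (\<rho> g * e) = mtrace (\<sigma> g * f)"
  shows "\<exists>U W. intertwines G d \<rho> \<sigma> U \<and> intertwines G d \<sigma> \<rho> W \<and>
     U * e = U \<and> f * U = U \<and> W * f = W \<and> e * W = W \<and> W * U = e \<and> U * W = f"
  using assms
proof (induction m arbitrary: e f rule: less_induct)
  case (less m)
  note e = less.prems(2,3) and f = less.prems(4,5) and ce = less.prems(6) and cf = less.prems(7)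
    and tr = less.prems(8)
  show ?case
  proof (cases "e = 0\<^sub>m d d")
    case True
    have "mtrace (\<rho> \<one> * e) = mtrace (\<sigma> \<one> * f)" by (rule tr) simp
    then have "mtrace f = 0" using True f(1) by (simp add: rho_one sigma_one mtrace_def)
    then have "f = 0\<^sub>m d d" using idempotent_trace[OF f] by (metis of_nat_eq_0_iff)
    then show ?thesis using True
      by (intro exI[of _ "0\<^sub>m d d"]) (auto simp: intertwines_def left_mult_zero_mat[of _ d d] right_mult_zero_mat[of _ d d])
  next
    case False
    obtain T where T: "intertwines G d \<rho> \<sigma> T" "T \<noteq> 0\<^sub>m d d" "T * e = T" "f * T = T"
      using nonzero_intertwiner[OF e f ce cf tr False] by blast
    obtain S1 where S1: "intertwines G d \<sigma> \<rho> S1" "T * S1 * T = T"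
      using intertwining_generalized_inverse[OF T(1)] by blast
    (* sandwiching with T makes S T S = S hold as well; the outer factors e and f keep S
       between the two images *)
    define S where "S = e * (S1 * (T * (S1 * f)))"
    have Tc: "T \<in> carrier_mat d d" and Ti: "\<And>g. g \<in> carrier G \<Longrightarrow> T * \<rho> g = \<sigma> g * T"
      using T by (auto simp: intertwines_def)
    have S1c: "S1 \<in> carrier_mat d d" and S1i: "\<And>g. g \<in> carrier G \<Longrightarrow> S1 * \<sigma> g = \<rho> g * S1"
      using S1 by (auto simp: intertwines_def)
    note c = Tc S1c e(1) f(1)
    have Sc: "S \<in> carrier_mat d d" using c by (simp add: S_def mat_simps)
    have Si: "S * \<sigma> g = \<rho> g * S" if g: "g \<in> carrier G" for g
    proof -
      have sw: "A * \<sigma> g = \<rho> g * A \<Longrightarrow> A \<in> carrier_mat d d \<Longrightarrow> X \<in> carrier_mat d d \<Longrightarrow> A * (\<sigma> g * X) = \<rho> g * (A * X)"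
        "A * \<rho> g = \<sigma> g * A \<Longrightarrow> A \<in> carrier_mat d d \<Longrightarrow> X \<in> carrier_mat d d \<Longrightarrow> A * (\<rho> g * X) = \<sigma> g * (A * X)"
        "A * \<rho> g = \<rho> g * A \<Longrightarrow> A \<in> carrier_mat d d \<Longrightarrow> X \<in> carrier_mat d d \<Longrightarrow> A * (\<rho> g * X) = \<rho> g * (A * X)" for A X
        using g by (simp_all add: assoc_mult_mat[symmetric, of _ d d _ d _ d])
      show ?thesis using g c unfolding S_def
        by (simp add: mat_simps ce cf Ti S1i sw)
    qed
    have shift: "A * (B * X) = C * X"
      if "A * B = C" "A \<in> carrier_mat d d" "B \<in> carrier_mat d d" "X \<in> carrier_mat d d" for A B C X
      using that by (simp flip: assoc_mult_mat[of A d d B d X d])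
    have mid: "T * (S1 * (T * X)) = T * X" if X: "X \<in> carrier_mat d d" for X
    proof -
      have "T * (S1 * (T * X)) = (T * S1 * T) * X" using X c by (simp add: mat_simps)
      then show ?thesis by (simp add: S1(2))
    qed
    note Te = shift[OF T(3)] and fT = shift[OF T(4)] and ee = shift[OF e(2)] and ff = shift[OF f(2)]
    have TS: "T * S = T * (S1 * f)" using c by (simp add: S_def mat_simps Te mid)
    have TST: "T * (S * T) = T"
    proof -
      have "T * (S * T) = (T * S) * T" using c Sc by (simp add: mat_simps)
      also have "\<dots> = T * S1 * T" using c by (simp add: TS mat_simps T(4))
      finally show ?thesis by (simp add: S1(2))
    qed
    have STS: "S * (T * S) = S"
      using c by (simp add: TS) (simp add: S_def mat_simps fT mid)
    have eS: "e * S = S" using c by (simp add: S_def mat_simps ee)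
    have Sf: "S * f = S" using c by (simp add: S_def mat_simps f(2))
    note eSX = shift[OF eS] and SfX = shift[OF Sf]
    have STSX: "S * (T * (S * X)) = S * X" and TSTX: "T * (S * (T * X)) = T * X"
      if X: "X \<in> carrier_mat d d" for X
    proof -
      have "S * (T * (S * X)) = (S * (T * S)) * X" "T * (S * (T * X)) = (T * (S * T)) * X"
        using X c Sc by (simp_all add: mat_simps)
      then show "S * (T * (S * X)) = S * X" "T * (S * (T * X)) = T * X" by (simp_all add: STS TST)
    qed
    define p where "p = S * T"
    define q where "q = T * S"
    have pc: "p \<in> carrier_mat d d" and qc: "q \<in> carrier_mat d d"
      using Sc Tc by (auto simp: p_def q_def mat_simps)
    have pp: "p * p = p" and ep: "e * p = p" and pe: "p * e = p"
      using Sc c by (simp_all add: p_def mat_simps TST T(3) eSX)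
    have qq: "q * q = q" and fq: "f * q = q" and qf: "q * f = q"
      using Sc c by (simp_all add: q_def mat_simps STS fT Sf)
    have cp: "p * \<rho> g = \<rho> g * p" if "g \<in> carrier G" for g
      using that Sc Tc by (simp add: p_def mat_simps Ti shift[OF Si])
    have cq: "q * \<sigma> g = \<sigma> g * q" if "g \<in> carrier G" for g
      using that Sc Tc by (simp add: q_def mat_simps Si shift[OF Ti])
    (* T p = T, so the rank strictly drops *)
    have "p \<noteq> 0\<^sub>m d d" using TST T(2) Tc by (auto simp: p_def)
    then obtain k where k: "mtrace p = of_nat k" "k > 0"
      using idempotent_trace[OF pc pp] by (metis gr0I)
    have cancel: "A - B - (B - B) = A - B" if "A \<in> carrier_mat d d" "B \<in> carrier_mat d d" for A B :: "complex mat"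
      using that by (auto intro!: eq_matI)
    have e': "e - p \<in> carrier_mat d d" "(e - p) * (e - p) = e - p"
      using e(1) pc by (auto simp: mat_simps e(2) pp ep pe cancel)
    have f': "f - q \<in> carrier_mat d d" "(f - q) * (f - q) = f - q"
      using f(1) qc by (auto simp: mat_simps f(2) qq fq qf cancel)
    obtain m' where m': "mtrace (e - p) = of_nat m'" using idempotent_trace[OF e'] by metis
    have "(of_nat m' :: complex) = of_nat m - of_nat k"
      using m' mtrace_minus[OF e(1) pc] less.prems(1) k by simp
    then have "(of_nat (m' + k) :: complex) = of_nat m" by simp
    then have "m' < m" using k(2) of_nat_eq_iff by (metis less_add_same_cancel1)
    have tr': "mtrace (\<rho> g * (e - p)) = mtrace (\<sigma> g * (f - q))" if g: "g \<in> carrier G" for g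
    proof -
      have "mtrace (\<rho> g * p) = mtrace ((\<rho> g * S) * T)" using g Sc Tc by (simp add: p_def mat_simps)
      also have "\<dots> = mtrace (T * (\<rho> g * S))"
        by (rule mtrace_mult_comm[of _ d d]) (use g Sc Tc in \<open>auto simp: mat_simps\<close>)
      also have "T * (\<rho> g * S) = \<sigma> g * q"
        using g Sc Tc by (simp add: q_def shift[OF Ti] mat_simps)
      finally show ?thesis using g e f pc qc tr[OF g]
        by (simp add: mat_simps mtrace_minus[of _ d])
    qed
    have ce': "(e - p) * \<rho> g = \<rho> g * (e - p)" if "g \<in> carrier G" for g
      using that e pc by (simp add: mat_simps ce cp)
    have cf': "(f - q) * \<sigma> g = \<sigma> g * (f - q)" if "g \<in> carrier G" for g
      using that f qc by (simp add: mat_simps cf cq)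
    from less.IH[OF \<open>m' < m\<close> m' e' f' ce' cf' tr'] obtain U W where
      U: "intertwines G d \<rho> \<sigma> U" "U * (e - p) = U" "(f - q) * U = U"
      and W: "intertwines G d \<sigma> \<rho> W" "W * (f - q) = W" "(e - p) * W = W"
      and UW: "W * U = e - p" "U * W = f - q" by auto
    have Uc: "U \<in> carrier_mat d d" and Ui: "\<And>g. g \<in> carrier G \<Longrightarrow> U * \<rho> g = \<sigma> g * U"
      using U by (auto simp: intertwines_def)
    have Wc: "W \<in> carrier_mat d d" and Wi: "\<And>g. g \<in> carrier G \<Longrightarrow> W * \<sigma> g = \<rho> g * W"
      using W by (auto simp: intertwines_def)
    have z1: "(f - q) * T = 0\<^sub>m d d" and z2: "S * (f - q) = 0\<^sub>m d d"
      and z3: "(e - p) * S = 0\<^sub>m d d" and z4: "T * (e - p) = 0\<^sub>m d d"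
      using c Sc by (simp_all add: mat_simps p_def q_def T(3,4) eS Sf TST STS)
    have WT: "W * T = 0\<^sub>m d d" 
      using Wc f'(1) Tc z1 assoc_mult_mat[OF Wc f'(1) Tc] by (simp add: W(2))
    have SU: "S * U = 0\<^sub>m d d"
      using Uc z2 assoc_mult_mat[OF Sc f'(1) Uc] by (simp add: U(3))
    have US: "U * S = 0\<^sub>m d d"
      using Uc z3 assoc_mult_mat[OF Uc e'(1) Sc] by (simp add: U(2))
    have TW: "T * W = 0\<^sub>m d d"
      using Wc z4 assoc_mult_mat[OF Tc e'(1) Wc] by (simp add: W(3))
    have absorb: "U * e = U" "f * U = U" "W * f = W" "e * W = W"
    proof -
      have "(e - p) * e = e - p" "f * (f - q) = f - q" "(f - q) * f = f - q" "e * (e - p) = e - p"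
        using e f pc qc ep pe fq qf by (simp_all add: mat_simps)
      with assoc_mult_mat[OF Uc e'(1) e(1)] assoc_mult_mat[OF f(1) f'(1) Uc]
        assoc_mult_mat[OF Wc f'(1) f(1)] assoc_mult_mat[OF e(1) e'(1) Wc]
      show "U * e = U" "f * U = U" "W * f = W" "e * W = W" by (simp_all add: U(2,3) W(2,3))
    qed
    show ?thesis
    proof (intro exI conjI)
      show "intertwines G d \<rho> \<sigma> (U + T)" "intertwines G d \<sigma> \<rho> (W + S)"
        using Uc Tc Wc Sc by (auto simp: intertwines_def mat_simps Ui Ti Wi Si)
      show "(U + T) * e = U + T" "f * (U + T) = U + T" "(W + S) * f = W + S" "e * (W + S) = W + S"
        using Uc Tc Wc Sc e(1) f(1) absorb T(3,4) eS Sf by (simp_all add: mat_simps)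
      show "(W + S) * (U + T) = e" "(U + T) * (W + S) = f"
        using Uc Tc Wc Sc e(1) f(1) pc qc
        by (simp_all add: mat_simps UW WT SU US TW p_def[symmetric] q_def[symmetric]) (auto intro!: eq_matI)
    qed
  qed
qed

theorem equal_characters_imp_equivalent:
  assumes "\<And>g. g \<in> carrier G \<Longrightarrow> mtrace (\<rho> g) = mtrace (\<sigma> g)"
  obtains P Q where "P \<in> carrier_mat d d" "Q \<in> carrier_mat d d" "P * Q = 1\<^sub>m d" "Q * P = 1\<^sub>m d"
    "\<And>g. g \<in> carrier G \<Longrightarrow> P * \<rho> g = \<sigma> g * P"
proof -
  have "\<exists>U W. intertwines G d \<rho> \<sigma> U \<and> intertwines G d \<sigma> \<rho> W \<and>
     U * 1\<^sub>m d = U \<and> 1\<^sub>m d * U = U \<and> W * 1\<^sub>m d = W \<and> 1\<^sub>m d * W = W \<and> W * U = 1\<^sub>m d \<and> U * W = 1\<^sub>m d"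
    by (rule intertwiner_pair_of_equal_traces[of _ d]) (use assms in \<open>auto simp: mtrace_one left_mult_one_mat[of _ d d] right_mult_one_mat[of _ d d]\<close>)
  then show thesis using that by (auto simp: intertwines_def)
qed

end

section \<open>Evaluating the characteristic polynomial\<close>

definition monomial_eval :: "(nat \<Rightarrow> complex) \<Rightarrow> (nat \<Rightarrow>\<^sub>0 nat) \<Rightarrow> complex" where
  "monomial_eval x m = (\<Prod>i\<in>Poly_Mapping.keys m. x i ^ Poly_Mapping.lookup m i)"

definition cpoly_eval :: "(nat \<Rightarrow> complex) \<Rightarrow> cpoly \<Rightarrow> complex" where
  "cpoly_eval x p = (\<Sum>m\<in>Poly_Mapping.keys p. Poly_Mapping.lookup p m * monomial_eval x m)"

lemma monomial_eval_superset:
  assumes "finite K" "Poly_Mapping.keys m \<subseteq> K"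
  shows "monomial_eval x m = (\<Prod>i\<in>K. x i ^ Poly_Mapping.lookup m i)"
  unfolding monomial_eval_def using assms
  by (intro prod.mono_neutral_left) (auto simp: in_keys_iff)

lemma monomial_eval_add: "monomial_eval x (m + m') = monomial_eval x m * monomial_eval x m'"
proof -
  let ?K = "Poly_Mapping.keys m \<union> Poly_Mapping.keys m'"
  have "monomial_eval x (m + m') = (\<Prod>i\<in>?K. x i ^ Poly_Mapping.lookup (m + m') i)"
    by (intro monomial_eval_superset) (auto dest: subsetD[OF Poly_Mapping.keys_add])
  also have "\<dots> = (\<Prod>i\<in>?K. x i ^ Poly_Mapping.lookup m i) * (\<Prod>i\<in>?K. x i ^ Poly_Mapping.lookup m' i)"
    by (simp add: lookup_add power_add prod.distrib)
  also have "\<dots> = monomial_eval x m * monomial_eval x m'"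
    by (simp add: monomial_eval_superset[of ?K])
  finally show ?thesis .
qed

lemma cpoly_eval_superset:
  assumes "finite K" "Poly_Mapping.keys p \<subseteq> K"
  shows "cpoly_eval x p = (\<Sum>m\<in>K. Poly_Mapping.lookup p m * monomial_eval x m)"
  unfolding cpoly_eval_def using assms
  by (intro sum.mono_neutral_left) (auto simp: in_keys_iff)

lemma cpoly_eval_add: "cpoly_eval x (p + q) = cpoly_eval x p + cpoly_eval x q"
proof -
  let ?K = "Poly_Mapping.keys p \<union> Poly_Mapping.keys q"
  have "cpoly_eval x (p + q) = (\<Sum>m\<in>?K. Poly_Mapping.lookup (p + q) m * monomial_eval x m)"
    by (intro cpoly_eval_superset) (auto dest: subsetD[OF Poly_Mapping.keys_add])
  also have "\<dots> = cpoly_eval x p + cpoly_eval x q"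
    by (simp add: lookup_add distrib_right sum.distrib cpoly_eval_superset[of ?K])
  finally show ?thesis .
qed

lemma cpoly_eval_single: "cpoly_eval x (Poly_Mapping.single m c) = c * monomial_eval x m"
  by (simp add: cpoly_eval_def)

lemma cpoly_eval_0[simp]: "cpoly_eval x 0 = 0"
  by (simp add: cpoly_eval_def)

lemma cpoly_eval_sum: "cpoly_eval x (\<Sum>i\<in>I. f i) = (\<Sum>i\<in>I. cpoly_eval x (f i))"
  by (induction I rule: infinite_finite_induct) (auto simp: cpoly_eval_add)

lemma cpoly_sum_of_singles: 
  fixes p :: cpoly
  shows "p = (\<Sum>m\<in>Poly_Mapping.keys p. Poly_Mapping.single m (Poly_Mapping.lookup p m))"
  by (rule poly_mapping_eqI) (auto simp: lookup_sum lookup_single when_def in_keys_iff)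

lemma cpoly_eval_mult: "cpoly_eval x (p * q) = cpoly_eval x p * cpoly_eval x q"
proof -
  have "p * q = (\<Sum>m\<in>Poly_Mapping.keys p. Poly_Mapping.single m (Poly_Mapping.lookup p m)) * (\<Sum>m\<in>Poly_Mapping.keys q. Poly_Mapping.single m (Poly_Mapping.lookup q m))"
    using cpoly_sum_of_singles[of p] cpoly_sum_of_singles[of q] by simp
  also have "\<dots> = (\<Sum>m\<in>Poly_Mapping.keys p. \<Sum>m'\<in>Poly_Mapping.keys q. Poly_Mapping.single (m + m') (Poly_Mapping.lookup p m * Poly_Mapping.lookup q m'))"
    by (simp add: sum_product mult_single)
  finally have "cpoly_eval x (p * q) =
      (\<Sum>m\<in>Poly_Mapping.keys p. \<Sum>m'\<in>Poly_Mapping.keys q. Poly_Mapping.lookup p m * Poly_Mapping.lookup q m' * monomial_eval x (m + m'))"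
    by (simp add: cpoly_eval_sum cpoly_eval_single)
  then show ?thesis
    by (simp add: cpoly_eval_def sum_product monomial_eval_add mult_ac)
qed

lemma comm_ring_hom_cpoly_eval: "comm_ring_hom (cpoly_eval x)"
  by unfold_locales
    (auto simp: cpoly_eval_add cpoly_eval_mult cpoly_eval_single monomial_eval_def simp flip: single_one)

lemma comm_ring_hom_cpoly_const: "comm_ring_hom cpoly_const"
  by unfold_locales (auto simp: cpoly_const_def single_add mult_single simp flip: single_one)

lemma cpoly_eval_var: "cpoly_eval x (cpoly_var i) = x i"
  and cpoly_eval_const: "cpoly_eval x (cpoly_const c) = c"
  by (auto simp: cpoly_var_def cpoly_const_def cpoly_eval_single monomial_eval_def)

definition lincomb_mat :: "nat \<Rightarrow> (nat \<Rightarrow> complex) \<Rightarrow> 'a list \<Rightarrow> ('a \<Rightarrow> complex mat) \<Rightarrow> complex mat" where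
  "lincomb_mat d c gs \<rho> = msum d (\<lambda>i. c i \<cdot>\<^sub>m \<rho> (gs ! i)) {..<length gs}"

lemma lincomb_mat_carrier[simp]: "lincomb_mat d c gs \<rho> \<in> carrier_mat d d"
  "dim_row (lincomb_mat d c gs \<rho>) = d" "dim_col (lincomb_mat d c gs \<rho>) = d"
  by (auto simp: lincomb_mat_def)

lemma index_lincomb_mat:
  assumes "\<And>g. g \<in> set gs \<Longrightarrow> \<rho> g \<in> carrier_mat d d" "i < d" "j < d"
  shows "lincomb_mat d c gs \<rho> $$ (i, j) = (\<Sum>k<length gs. c k * \<rho> (gs ! k) $$ (i, j))"
proof -
  have "(c k \<cdot>\<^sub>m \<rho> (gs ! k)) $$ (i, j) = c k * \<rho> (gs ! k) $$ (i, j)" if "k < length gs" for k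
    using assms(1)[of "gs ! k"] assms(2,3) that by simp
  then show ?thesis using assms(2,3) by (simp add: lincomb_mat_def msum_def)
qed

lemma eval_rep_charpoly:
  assumes "\<And>g. g \<in> set gs \<Longrightarrow> \<rho> g \<in> carrier_mat d d"
  shows "cpoly_eval x (rep_charpoly gs d \<rho>) = det (x 0 \<cdot>\<^sub>m 1\<^sub>m d + lincomb_mat d (\<lambda>i. x (Suc i)) gs \<rho>)"
proof -
  interpret comm_ring_hom "cpoly_eval x" by (rule comm_ring_hom_cpoly_eval)
  show ?thesis unfolding rep_charpoly_def hom_det[symmetric] using assms
    by (intro arg_cong[where f = det] eq_matI)
      (auto simp: index_lincomb_mat cpoly_eval_add cpoly_eval_mult cpoly_eval_sum cpoly_eval_var cpoly_eval_const)
qed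

text \<open>
  The coefficient of the identity matrix is a free variable of the polynomial, so equality of the
  polynomials gives equal characteristic polynomials for all linear combinations, not only equal
  determinants. The degree is recovered by evaluating at \<open>(2, 0, 0, \<dots>)\<close>, where the determinant is
  \<open>2\<^sup>d\<close>.
\<close>
lemma rep_charpoly_eq_imp_trace_pow_eq:
  assumes "\<And>g. g \<in> set gs \<Longrightarrow> \<rho> g \<in> carrier_mat d1 d1" "\<And>g. g \<in> set gs \<Longrightarrow> \<sigma> g \<in> carrier_mat d2 d2"
    and eq: "rep_charpoly gs d1 \<rho> = rep_charpoly gs d2 \<sigma>"
  shows "d1 = d2" and "mtrace (lincomb_mat d1 c gs \<rho> ^\<^sub>m k) = mtrace (lincomb_mat d2 c gs \<sigma> ^\<^sub>m k)"
proof -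
  have det: "det (z \<cdot>\<^sub>m 1\<^sub>m d1 + lincomb_mat d1 b gs \<rho>) = det (z \<cdot>\<^sub>m 1\<^sub>m d2 + lincomb_mat d2 b gs \<sigma>)" for z b
  proof -
    define x where "x i = (case i of 0 \<Rightarrow> z | Suc j \<Rightarrow> b j)" for i
    have "x 0 = z" "(\<lambda>i. x (Suc i)) = b" by (auto simp: x_def)
    then show ?thesis
      using eval_rep_charpoly[of gs \<rho> d1 x, OF assms(1)] eval_rep_charpoly[of gs \<sigma> d2 x, OF assms(2)] eq by simp
  qed
  have "lincomb_mat d (\<lambda>_. 0) gs \<tau> = 0\<^sub>m d d" if "\<And>g. g \<in> set gs \<Longrightarrow> \<tau> g \<in> carrier_mat d d" for \<tau> d
    using that by (intro eq_matI) (auto simp: index_lincomb_mat)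
  then have "(2 :: complex) ^ d1 = 2 ^ d2"
    using det[of 2 "\<lambda>_. 0"] assms by simp
  then have "(2 :: nat) ^ d1 = 2 ^ d2" by (metis of_nat_eq_iff of_nat_numeral of_nat_power)
  then show "d1 = d2" by simp
  have "poly (char_poly (lincomb_mat d c gs \<tau>)) z = det (z \<cdot>\<^sub>m 1\<^sub>m d + lincomb_mat d (\<lambda>i. - c i) gs \<tau>)"
    if "\<And>g. g \<in> set gs \<Longrightarrow> \<tau> g \<in> carrier_mat d d" for \<tau> d z
    unfolding char_poly_matrix[OF lincomb_mat_carrier(1)] using that
    by (intro arg_cong[where f = det] eq_matI) (auto simp: char_matrix_def index_lincomb_mat sum_negf)
  then have cp: "char_poly (lincomb_mat d1 c gs \<rho>) = char_poly (lincomb_mat d2 c gs \<sigma>)"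
    using det assms by (intro poly_eq_poly_eq_iff[THEN iffD1] ext) auto
  obtain es where es: "char_poly (lincomb_mat d1 c gs \<rho>) = (\<Prod>e\<leftarrow>es. [:- e, 1:])"
    using char_poly_factorized[OF lincomb_mat_carrier(1)] by blast
  show "mtrace (lincomb_mat d1 c gs \<rho> ^\<^sub>m k) = mtrace (lincomb_mat d2 c gs \<sigma> ^\<^sub>m k)"
    using trace_pow_eigenvalues(1)[OF lincomb_mat_carrier(1) es, of k] 
      trace_pow_eigenvalues(1)[OF lincomb_mat_carrier(1) es[unfolded cp], of k] by simp
qed

text \<open>
  The intertwiner, read as a matrix of constant polynomials, conjugates the two pencils; its
  determinant is a nonzero constant and can be cancelled in the polynomial ring.
\<close>
lemma rep_charpoly_similar:
  assumes "\<And>g. g \<in> set gs \<Longrightarrow> \<rho> g \<in> carrier_mat d d" "\<And>g. g \<in> set gs \<Longrightarrow> \<sigma> g \<in> carrier_mat d d"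
    and P: "P \<in> carrier_mat d d" "det P \<noteq> 0" and int: "\<And>g. g \<in> set gs \<Longrightarrow> P * \<rho> g = \<sigma> g * P"
  shows "rep_charpoly gs d \<rho> = rep_charpoly gs d \<sigma>"
proof -
  interpret comm_ring_hom cpoly_const by (rule comm_ring_hom_cpoly_const)
  define P' where "P' = map_mat cpoly_const P"
  define pencil where "pencil \<tau> = cpoly_var 0 \<cdot>\<^sub>m 1\<^sub>m d
          + mat d d (\<lambda>(a, b). \<Sum>i<length gs. cpoly_var (Suc i) * cpoly_const (\<tau> (gs ! i) $$ (a, b)))" for \<tau>
  have P': "P' \<in> carrier_mat d d" and pc: "pencil \<tau> \<in> carrier_mat d d" for \<tau>
    using P by (auto simp: P'_def pencil_def)
  have "P' * pencil \<rho> = pencil \<sigma> * P'"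
  proof (rule eq_matI)
    fix a b assume "a < dim_row (pencil \<sigma> * P')" "b < dim_col (pencil \<sigma> * P')"
    then have ab: "a < d" "b < d" using P' carrier_matD[OF pc[of \<sigma>]] by auto
    have entry: "(\<Sum>l<d. P $$ (a, l) * \<rho> (gs ! i) $$ (l, b)) = (\<Sum>l<d. \<sigma> (gs ! i) $$ (a, l) * P $$ (l, b))"
      if "i < length gs" for i
      using int[of "gs ! i"] that ab P assms(1,2)[of "gs ! i"]
        index_mult_mat_sum[of P d d "\<rho> (gs ! i)" d a b] index_mult_mat_sum[of "\<sigma> (gs ! i)" d d P d a b] by simp
    have "(P' * pencil \<rho>) $$ (a, b) = (\<Sum>l<d. P' $$ (a, l) * ((if l = b then cpoly_var 0 else 0) +
       (\<Sum>i<length gs. cpoly_var (Suc i) * cpoly_const (\<rho> (gs ! i) $$ (l, b)))))"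
      using ab by (subst index_mult_mat_sum[OF P' pc]) (auto simp: pencil_def intro!: sum.cong)
    also have "\<dots> = cpoly_var 0 * P' $$ (a, b) + (\<Sum>i<length gs. cpoly_var (Suc i) * 
       cpoly_const (\<Sum>l<d. P $$ (a, l) * \<rho> (gs ! i) $$ (l, b)))"
    proof -
      have "(\<Sum>l<d. P' $$ (a, l) * (if l = b then cpoly_var 0 else 0)) = cpoly_var 0 * P' $$ (a, b)"
        using ab by (simp add: if_distrib mult.commute cong: if_cong)
      moreover have "(\<Sum>l<d. P' $$ (a, l) * (\<Sum>i<length gs. cpoly_var (Suc i) * cpoly_const (\<rho> (gs ! i) $$ (l, b)))) =
        (\<Sum>i<length gs. cpoly_var (Suc i) * cpoly_const (\<Sum>l<d. P $$ (a, l) * \<rho> (gs ! i) $$ (l, b)))"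
        using ab P by (simp add: hom_sum hom_mult sum_distrib_left P'_def) (subst sum.swap, simp add: mult_ac)
      ultimately show ?thesis by (simp add: distrib_left sum.distrib)
    qed
    also have "\<dots> = cpoly_var 0 * P' $$ (a, b) + (\<Sum>i<length gs. cpoly_var (Suc i) * 
       cpoly_const (\<Sum>l<d. \<sigma> (gs ! i) $$ (a, l) * P $$ (l, b)))"
      using entry by simp
    also have "\<dots> = (\<Sum>l<d. ((if l = a then cpoly_var 0 else 0) +
       (\<Sum>i<length gs. cpoly_var (Suc i) * cpoly_const (\<sigma> (gs ! i) $$ (a, l)))) * P' $$ (l, b))"
    proof -
      have "(\<Sum>l<d. (if l = a then cpoly_var 0 else 0) * P' $$ (l, b)) = cpoly_var 0 * P' $$ (a, b)"
        using ab by (simp add: if_distribR if_distrib[of "\<lambda>x. x * _"] cong: if_cong)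
      moreover have "(\<Sum>l<d. (\<Sum>i<length gs. cpoly_var (Suc i) * cpoly_const (\<sigma> (gs ! i) $$ (a, l))) * P' $$ (l, b)) =
        (\<Sum>i<length gs. cpoly_var (Suc i) * cpoly_const (\<Sum>l<d. \<sigma> (gs ! i) $$ (a, l) * P $$ (l, b)))"
        using ab P by (simp add: hom_sum hom_mult sum_distrib_left sum_distrib_right P'_def) (subst sum.swap, simp add: mult_ac)
      ultimately show ?thesis by (simp add: distrib_right sum.distrib)
    qed
    also have "\<dots> = (pencil \<sigma> * P') $$ (a, b)"
      using ab by (subst index_mult_mat_sum[OF pc P']) (auto simp: pencil_def intro!: sum.cong)
    finally show "(P' * pencil \<rho>) $$ (a, b) = (pencil \<sigma> * P') $$ (a, b)" .
  qed (use P' carrier_matD[OF pc[of \<rho>]] carrier_matD[OF pc[of \<sigma>]] in auto)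
  then have "det P' * det (pencil \<rho>) = det P' * det (pencil \<sigma>)"
    using det_mult[OF P' pc[of \<rho>]] det_mult[OF pc[of \<sigma>] P'] by (metis mult.commute)
  then have "cpoly_const (1 / det P) * cpoly_const (det P) * det (pencil \<rho>) =
      cpoly_const (1 / det P) * cpoly_const (det P) * det (pencil \<sigma>)"
    by (simp add: P'_def mult.assoc)
  then show ?thesis using P(2) by (simp add: rep_charpoly_def pencil_def hom_mult[symmetric])
qed

section \<open>Extracting traces of single elements by differentiation\<close>

text \<open>The coefficient of \<open>t\<close> in \<open>(Y + t Z)\<^sup>k\<close>, by the product rule for noncommuting factors.\<close>
fun pow_deriv :: "complex mat \<Rightarrow> complex mat \<Rightarrow> nat \<Rightarrow> complex mat" where
  "pow_deriv Y Z 0 = 0\<^sub>m (dim_row Y) (dim_row Y)"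
| "pow_deriv Y Z (Suc k) = pow_deriv Y Z k * Y + Y ^\<^sub>m k * Z"

lemma pow_deriv_carrier:
  assumes "Y \<in> carrier_mat d d" "Z \<in> carrier_mat d d"
  shows "pow_deriv Y Z k \<in> carrier_mat d d"
  using assms by (induction k) (auto simp: mult_carrier_mat[of _ d d] pow_carrier_mat)

lemma has_field_derivative_pow_mat:
  assumes Y: "Y \<in> carrier_mat d d" and Z: "Z \<in> carrier_mat d d" and "i < d" "j < d"
  shows "((\<lambda>t. ((Y + t \<cdot>\<^sub>m Z) ^\<^sub>m k) $$ (i, j)) has_field_derivative pow_deriv Y Z k $$ (i, j)) (at 0)"
  using assms(4)
proof (induction k arbitrary: j)
  case 0
  then show ?case using assms by simp
next
  case (Suc k)
  have c: "Y + t \<cdot>\<^sub>m Z \<in> carrier_mat d d" for t using Y Z by simp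
  have pc: "(Y + t \<cdot>\<^sub>m Z) ^\<^sub>m k \<in> carrier_mat d d" for t using c by (simp add: pow_carrier_mat)
  have "Y + 0 \<cdot>\<^sub>m Z = Y" using Y Z by (auto intro!: eq_matI)
  have eq: "((Y + t \<cdot>\<^sub>m Z) ^\<^sub>m Suc k) $$ (i, j) =
     (\<Sum>l<d. ((Y + t \<cdot>\<^sub>m Z) ^\<^sub>m k) $$ (i, l) * (Y $$ (l, j) + t * Z $$ (l, j)))" for t
    using Suc.prems assms(3) Y Z by (simp add: index_mult_mat_sum[OF pc c] del: index_mult_mat(1))
  have D: "((\<lambda>t. \<Sum>l<d. ((Y + t \<cdot>\<^sub>m Z) ^\<^sub>m k) $$ (i, l) * (Y $$ (l, j) + t * Z $$ (l, j))) has_field_derivative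
     (\<Sum>l<d. (pow_deriv Y Z k $$ (i, l) * (Y $$ (l, j) + 0 * Z $$ (l, j)) + 
        Z $$ (l, j) * ((Y + 0 \<cdot>\<^sub>m Z) ^\<^sub>m k) $$ (i, l)))) (at 0)"
    by (intro DERIV_sum DERIV_mult' derivative_eq_intros Suc.IH) (auto intro!: derivative_eq_intros Suc.IH simp: mult_ac)
  have "pow_deriv Y Z (Suc k) $$ (i, j) = (\<Sum>l<d. pow_deriv Y Z k $$ (i, l) * Y $$ (l, j)) + (\<Sum>l<d. (Y ^\<^sub>m k) $$ (i, l) * Z $$ (l, j))"
    using Suc.prems assms pow_deriv_carrier[OF Y Z, of k]
    by (simp add: index_mult_mat_sum[of _ d d _ d] pow_carrier_mat mult_carrier_mat[of _ d d] del: index_mult_mat(1))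
  also have "\<dots> = (\<Sum>l<d. (pow_deriv Y Z k $$ (i, l) * (Y $$ (l, j) + 0 * Z $$ (l, j)) + 
        Z $$ (l, j) * ((Y + 0 \<cdot>\<^sub>m Z) ^\<^sub>m k) $$ (i, l)))"
    by (simp add: sum.distrib \<open>Y + 0 \<cdot>\<^sub>m Z = Y\<close> mult_ac)
  finally show ?case unfolding eq using D by simp
qed

lemma trace_pow_deriv_eq:
  fixes M1 Y1 Z1 M2 Y2 Z2 :: "complex mat"
  assumes "M1 \<in> carrier_mat d d" "Y1 \<in> carrier_mat d d" "Z1 \<in> carrier_mat d d"
    and "M2 \<in> carrier_mat d d" "Y2 \<in> carrier_mat d d" "Z2 \<in> carrier_mat d d"
    and eq: "\<And>t. mtrace (M1 * (Y1 + t \<cdot>\<^sub>m Z1) ^\<^sub>m k) = mtrace (M2 * (Y2 + t \<cdot>\<^sub>m Z2) ^\<^sub>m k)"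
  shows "mtrace (M1 * pow_deriv Y1 Z1 k) = mtrace (M2 * pow_deriv Y2 Z2 k)"
proof -
  have ev: "mtrace (M * (Y + t \<cdot>\<^sub>m Z) ^\<^sub>m k) = (\<Sum>i<d. \<Sum>l<d. M $$ (i, l) * ((Y + t \<cdot>\<^sub>m Z) ^\<^sub>m k) $$ (l, i))"
    and D: "((\<lambda>t. mtrace (M * (Y + t \<cdot>\<^sub>m Z) ^\<^sub>m k)) has_field_derivative mtrace (M * pow_deriv Y Z k)) (at 0)"
    if M: "M \<in> carrier_mat d d" and Y: "Y \<in> carrier_mat d d" and Z: "Z \<in> carrier_mat d d" for M Y Z t
  proof -
    have c: "(Y + t \<cdot>\<^sub>m Z) ^\<^sub>m k \<in> carrier_mat d d" for t using Y Z by (simp add: pow_carrier_mat)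
    show ev: "mtrace (M * (Y + t \<cdot>\<^sub>m Z) ^\<^sub>m k) = (\<Sum>i<d. \<Sum>l<d. M $$ (i, l) * ((Y + t \<cdot>\<^sub>m Z) ^\<^sub>m k) $$ (l, i))" for t
      using M by (simp add: mtrace_def index_mult_mat_sum[OF M c] del: index_mult_mat(1))
    have "mtrace (M * pow_deriv Y Z k) = (\<Sum>i<d. \<Sum>l<d. M $$ (i, l) * pow_deriv Y Z k $$ (l, i))"
      using M by (simp add: mtrace_def index_mult_mat_sum[OF M pow_deriv_carrier[OF Y Z]] del: index_mult_mat(1))
    then show "((\<lambda>t. mtrace (M * (Y + t \<cdot>\<^sub>m Z) ^\<^sub>m k)) has_field_derivative mtrace (M * pow_deriv Y Z k)) (at 0)"
      unfolding ev by (auto intro!: DERIV_sum DERIV_cmult has_field_derivative_pow_mat[OF Y Z])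
  qed
  show ?thesis
    using D[OF assms(1-3)] D[OF assms(4-6)] by (auto simp: eq intro: DERIV_unique)
qed

text \<open>
  By cyclicity of the trace, the \<open>k + 1\<close> positions at which \<open>Z\<close> can be inserted all contribute the
  same. The extra factor \<open>Y\<^sup>m\<close> is what makes the induction on \<open>k\<close> work.
\<close>
lemma trace_pow_deriv:
  assumes "Y \<in> carrier_mat d d" "Z \<in> carrier_mat d d"
  shows "mtrace (pow_deriv Y Z (Suc k) * Y ^\<^sub>m m) = of_nat (Suc k) * mtrace (Z * Y ^\<^sub>m (k + m))"
proof (induction k arbitrary: m)
  case 0
  then show ?case using assms by (simp add: pow_carrier_mat)
next
  case (Suc k)
  note c = assms pow_deriv_carrier[OF assms, of "Suc k"] pow_carrier_mat[OF assms(1)]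
  have "pow_deriv Y Z (Suc (Suc k)) * Y ^\<^sub>m m = pow_deriv Y Z (Suc k) * (Y * Y ^\<^sub>m m) + Y ^\<^sub>m Suc k * (Z * Y ^\<^sub>m m)"
    using c by (subst pow_deriv.simps(2)) (simp add: add_mult_distrib_mat[of _ d d _ _ d] assoc_mult_mat[of _ d d _ d _ d]
        mult_carrier_mat[of _ d d] del: pow_deriv.simps)
  moreover have "Y * Y ^\<^sub>m m = Y ^\<^sub>m Suc m" using pow_mat_add[OF assms(1), of 1 m] assms by simp
  moreover have "mtrace (Y ^\<^sub>m Suc k * (Z * Y ^\<^sub>m m)) = mtrace (Z * Y ^\<^sub>m (m + Suc k))"
    using c by (subst mtrace_mult_comm[of _ d d]) (auto simp: pow_mat_add[OF assms(1), of m "Suc k", symmetric] assoc_mult_mat[of _ d d _ d _ d]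
        mult_carrier_mat[of _ d d] simp del: pow_mat.simps)
  moreover have "mtrace (pow_deriv Y Z (Suc k) * Y ^\<^sub>m Suc m) = of_nat (Suc k) * mtrace (Z * Y ^\<^sub>m (k + Suc m))"
    by (rule Suc.IH)
  ultimately show ?case using c
    by (simp add: mtrace_add[of _ d] mult_carrier_mat[of _ d d] algebra_simps del: pow_deriv.simps pow_mat.simps)
qed

text \<open>
  The counterpart of \<open>trace_pow_deriv\<close> under a commutation assumption. It is an identity of
  matrices, so it can be used inside a product whose other factors do not commute with \<open>Y\<close>.
\<close>
lemma pow_deriv_commute:
  assumes "Y \<in> carrier_mat d d" "Z \<in> carrier_mat d d" "Z * Y = Y * Z"
  shows "pow_deriv Y Z (Suc k) = of_nat (Suc k) \<cdot>\<^sub>m (Z * Y ^\<^sub>m k)"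
proof (induction k)
  case 0
  then show ?case using assms by (auto intro!: eq_matI)
next
  case (Suc k)
  note c = assms(1,2) pow_carrier_mat[OF assms(1)]
  have "Y ^\<^sub>m m * Z = Z * Y ^\<^sub>m m" for m
  proof (induction m)
    case (Suc m)
    have "Y ^\<^sub>m Suc m * Z = Y ^\<^sub>m m * (Z * Y)" using c assms(3) by (simp add: assoc_mult_mat[of _ d d _ d _ d])
    also have "\<dots> = Z * Y ^\<^sub>m m * Y" using c Suc by (simp flip: assoc_mult_mat[of _ d d _ d _ d])
    finally show ?case using c by (simp add: assoc_mult_mat[of _ d d _ d _ d])
  qed (use c in simp)
  then have "pow_deriv Y Z (Suc (Suc k)) = of_nat (Suc k) \<cdot>\<^sub>m (Z * Y ^\<^sub>m k) * Y + Z * Y ^\<^sub>m (Suc k)"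
    by (subst pow_deriv.simps(2)) (simp add: Suc del: pow_deriv.simps pow_mat.simps)
  also have "\<dots> = of_nat (Suc k) \<cdot>\<^sub>m (Z * Y ^\<^sub>m Suc k) + Z * Y ^\<^sub>m (Suc k)"
    using c by (simp add: mult_smult_assoc_mat[of _ d d _ d] assoc_mult_mat[of _ d d _ d _ d] mult_carrier_mat[of _ d d])
  also have "\<dots> = of_nat (Suc (Suc k)) \<cdot>\<^sub>m (Z * Y ^\<^sub>m Suc k)"
    using c by (auto intro!: eq_matI simp: distrib_right simp del: index_mult_mat(1) pow_mat.simps)
  finally show ?case .
qed


inductive_set gen_monoid :: "('a, 'b) monoid_scheme \<Rightarrow> 'a set \<Rightarrow> 'a set"
  for G (structure) and Y where
  one: "\<one> \<in> gen_monoid G Y"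
| mult: "a \<in> gen_monoid G Y \<Longrightarrow> y \<in> Y \<Longrightarrow> a \<otimes> y \<in> gen_monoid G Y"

lemma lincomb_mat_upd:
  assumes "\<And>g. g \<in> set gs \<Longrightarrow> \<rho> g \<in> carrier_mat d d" "k < length gs"
  shows "lincomb_mat d (c(k := c k + t)) gs \<rho> = lincomb_mat d c gs \<rho> + t \<cdot>\<^sub>m \<rho> (gs ! k)"
proof (rule eq_matI)
  fix i j assume "i < dim_row (lincomb_mat d c gs \<rho> + t \<cdot>\<^sub>m \<rho> (gs ! k))" "j < dim_col (lincomb_mat d c gs \<rho> + t \<cdot>\<^sub>m \<rho> (gs ! k))"
  then have ij: "i < d" "j < d" using assms by (auto simp: carrier_matD[OF assms(1)])
  have "(\<Sum>l<length gs. (c(k := c k + t)) l * \<rho> (gs ! l) $$ (i, j)) =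
     (\<Sum>l<length gs. c l * \<rho> (gs ! l) $$ (i, j) + (if l = k then t * \<rho> (gs ! k) $$ (i, j) else 0))"
    by (intro sum.cong) (auto simp: distrib_right)
  then show "lincomb_mat d (c(k := c k + t)) gs \<rho> $$ (i, j) = (lincomb_mat d c gs \<rho> + t \<cdot>\<^sub>m \<rho> (gs ! k)) $$ (i, j)"
    using ij assms carrier_matD[OF assms(1)[of "gs ! k"]] by (simp add: index_lincomb_mat sum.distrib)
qed (use assms in \<open>auto simp: carrier_matD[OF assms(1)]\<close>)

lemma lincomb_mat_commute:
  assumes "\<And>g. g \<in> set gs \<Longrightarrow> \<rho> g \<in> carrier_mat d d" and Z: "Z \<in> carrier_mat d d"
    and comm: "\<And>i. i < length gs \<Longrightarrow> c i \<noteq> 0 \<Longrightarrow> Z * \<rho> (gs ! i) = \<rho> (gs ! i) * Z"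
  shows "Z * lincomb_mat d c gs \<rho> = lincomb_mat d c gs \<rho> * Z"
proof -
  have "Z * lincomb_mat d c gs \<rho> = msum d (\<lambda>i. Z * (c i \<cdot>\<^sub>m \<rho> (gs ! i))) {..<length gs}"
    unfolding lincomb_mat_def using assms by (subst mult_msum) auto
  also have "\<dots> = msum d (\<lambda>i. (c i \<cdot>\<^sub>m \<rho> (gs ! i)) * Z) {..<length gs}"
  proof (rule msum_cong)
    fix i assume "i \<in> {..<length gs}"
    then have i: "i < length gs" "\<rho> (gs ! i) \<in> carrier_mat d d" using assms(1) by auto
    show "Z * (c i \<cdot>\<^sub>m \<rho> (gs ! i)) = (c i \<cdot>\<^sub>m \<rho> (gs ! i)) * Z"
    proof (cases "c i = 0")
      case True
      then show ?thesis using i Z by (auto intro!: eq_matI)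
    next
      case False
      then show ?thesis using i Z comm
        by (simp add: mult_smult_distrib[of _ d d _ d] mult_smult_assoc_mat[of _ d d _ d])
    qed
  qed
  also have "\<dots> = lincomb_mat d c gs \<rho> * Z"
    unfolding lincomb_mat_def using assms by (subst msum_mult) auto
  finally show ?thesis .
qed

text \<open>
  The letters of \<open>s \<otimes> a\<close> are inserted one by one. The letter \<open>s\<close> comes first, by differentiating the
  trace of \<open>M(c)\<^bsup>k+1\<^esup>\<close>, where no commutation is available and cyclicity of the trace is used. After
  that \<open>c\<close> is restricted to coefficients supported on the commuting set \<open>Y\<close>, so that each further
  derivative in the direction of a letter \<open>y \<in> Y\<close> multiplies \<open>\<rho>(s \<otimes> a)\<close> by \<open>\<rho>(y)\<close> up to a nonzero
  factor. Keeping a free power \<open>M(c)\<^sup>k\<close> in the invariant leaves room for the next letter; finally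
  \<open>k = 0\<close>.
\<close>
lemma trace_pow_eq_imp_trace_eq:
  fixes G :: "('a, 'b) monoid_scheme" (structure)
  assumes "monoid G" and gs: "set gs \<subseteq> carrier G"
    and rc: "\<And>g. g \<in> carrier G \<Longrightarrow> \<rho> g \<in> carrier_mat d d"
    and sc: "\<And>g. g \<in> carrier G \<Longrightarrow> \<sigma> g \<in> carrier_mat d d"
    and rm: "\<And>g h. g \<in> carrier G \<Longrightarrow> h \<in> carrier G \<Longrightarrow> \<rho> (g \<otimes> h) = \<rho> g * \<rho> h"
    and sm: "\<And>g h. g \<in> carrier G \<Longrightarrow> h \<in> carrier G \<Longrightarrow> \<sigma> (g \<otimes> h) = \<sigma> g * \<sigma> h"
    and eq: "\<And>c k. mtrace (lincomb_mat d c gs \<rho> ^\<^sub>m k) = mtrace (lincomb_mat d c gs \<sigma> ^\<^sub>m k)"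
    and Y: "Y \<subseteq> set gs" and comm: "\<And>y z. y \<in> Y \<Longrightarrow> z \<in> Y \<Longrightarrow> y \<otimes> z = z \<otimes> y"
    and s: "s \<in> set gs" and a: "a \<in> gen_monoid G Y"
  shows "mtrace (\<rho> (s \<otimes> a)) = mtrace (\<sigma> (s \<otimes> a))"
proof -
  interpret monoid G by fact
  have rg: "\<And>g. g \<in> set gs \<Longrightarrow> \<rho> g \<in> carrier_mat d d" and sg: "\<And>g. g \<in> set gs \<Longrightarrow> \<sigma> g \<in> carrier_mat d d"
    using rc sc gs by auto
  define supp where "supp c \<longleftrightarrow> (\<forall>i<length gs. c i \<noteq> 0 \<longrightarrow> gs ! i \<in> Y)" for c :: "nat \<Rightarrow> complex"
  have "a \<in> carrier G \<and> (\<forall>c k. supp c \<longrightarrow>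
     mtrace (\<rho> (s \<otimes> a) * lincomb_mat d c gs \<rho> ^\<^sub>m k) = mtrace (\<sigma> (s \<otimes> a) * lincomb_mat d c gs \<sigma> ^\<^sub>m k))"
    using a
  proof induction
    case one
    obtain n where n: "n < length gs" "gs ! n = s" using s by (auto simp: in_set_conv_nth)
    have tr: "mtrace (\<rho> s * lincomb_mat d c gs \<rho> ^\<^sub>m k) = mtrace (\<sigma> s * lincomb_mat d c gs \<sigma> ^\<^sub>m k)" for c k
    proof -
      let ?P = "pow_deriv (lincomb_mat d c gs \<rho>) (\<rho> s) (Suc k)"
      let ?Q = "pow_deriv (lincomb_mat d c gs \<sigma>) (\<sigma> s) (Suc k)"
      have upd: "lincomb_mat d c gs \<rho> + t \<cdot>\<^sub>m \<rho> s = lincomb_mat d (c(n := c n + t)) gs \<rho>"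
        "lincomb_mat d c gs \<sigma> + t \<cdot>\<^sub>m \<sigma> s = lincomb_mat d (c(n := c n + t)) gs \<sigma>" for t
        using lincomb_mat_upd[of gs \<rho> d n c t, OF rg n(1)] lincomb_mat_upd[of gs \<sigma> d n c t, OF sg n(1)] n(2) by simp_all
      have pc: "lincomb_mat d b gs \<tau> ^\<^sub>m m \<in> carrier_mat d d" for b m \<tau>
        by (simp add: pow_carrier_mat)
      have "mtrace (1\<^sub>m d * ?P) = mtrace (1\<^sub>m d * ?Q)"
        by (rule trace_pow_deriv_eq)
          (use rg[OF s] sg[OF s] in \<open>simp_all add: upd left_mult_one_mat[OF pc] eq del: pow_mat.simps\<close>)
      then have "mtrace ?P = mtrace ?Q"
        by (simp only: left_mult_one_mat[OF pow_deriv_carrier[OF lincomb_mat_carrier(1) rg[OF s]]]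
            left_mult_one_mat[OF pow_deriv_carrier[OF lincomb_mat_carrier(1) sg[OF s]]])
      moreover have "mtrace (pow_deriv (lincomb_mat d c gs \<tau>) Z (Suc k)) =
          of_nat (Suc k) * mtrace (Z * lincomb_mat d c gs \<tau> ^\<^sub>m k)" if Z: "Z \<in> carrier_mat d d" for Z \<tau>
        using trace_pow_deriv[OF lincomb_mat_carrier(1)[of d c gs \<tau>] Z, of k 0]
        by (simp add: right_mult_one_mat[OF pow_deriv_carrier[OF lincomb_mat_carrier(1) Z]] del: pow_deriv.simps)
      ultimately show ?thesis
        using rg[OF s] sg[OF s] by (simp del: pow_deriv.simps of_nat_Suc)
    qed
    then show ?case using gs s by auto
  next
    case (mult a y)
    have ac: "a \<in> carrier G" and y: "y \<in> set gs" "y \<in> carrier G" "s \<in> carrier G"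
      using mult Y gs s by auto
    obtain n where n: "n < length gs" "gs ! n = y" using y by (auto simp: in_set_conv_nth)
    have "mtrace (\<rho> (s \<otimes> (a \<otimes> y)) * lincomb_mat d c gs \<rho> ^\<^sub>m k) = mtrace (\<sigma> (s \<otimes> (a \<otimes> y)) * lincomb_mat d c gs \<sigma> ^\<^sub>m k)"
      if c: "supp c" for c k
    proof -
      have upd: "lincomb_mat d c gs \<rho> + t \<cdot>\<^sub>m \<rho> y = lincomb_mat d (c(n := c n + t)) gs \<rho>"
        "lincomb_mat d c gs \<sigma> + t \<cdot>\<^sub>m \<sigma> y = lincomb_mat d (c(n := c n + t)) gs \<sigma>" for t
        using lincomb_mat_upd[of gs \<rho> d n c t, OF rg n(1)] lincomb_mat_upd[of gs \<sigma> d n c t, OF sg n(1)] n(2) by simp_all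
      have supp: "supp (c(n := c n + t))" for t using c n mult.hyps(2) by (auto simp: supp_def)
      have sa: "s \<otimes> a \<in> carrier G" using ac y by simp
      have *: "mtrace (\<rho> (s \<otimes> a) * pow_deriv (lincomb_mat d c gs \<rho>) (\<rho> y) (Suc k)) =
            mtrace (\<sigma> (s \<otimes> a) * pow_deriv (lincomb_mat d c gs \<sigma>) (\<sigma> y) (Suc k))"
        by (rule trace_pow_deriv_eq)
          (use rc[OF y(2)] sc[OF y(2)] rc[OF sa] sc[OF sa] mult.IH supp in \<open>simp_all add: upd del: pow_mat.simps\<close>)
      have comm_y: "\<tau> y * lincomb_mat d c gs \<tau> = lincomb_mat d c gs \<tau> * \<tau> y"
        if "\<And>g. g \<in> carrier G \<Longrightarrow> \<tau> g \<in> carrier_mat d d"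
          "\<And>g h. g \<in> carrier G \<Longrightarrow> h \<in> carrier G \<Longrightarrow> \<tau> (g \<otimes> h) = \<tau> g * \<tau> h" for \<tau>
      proof (rule lincomb_mat_commute)
        fix i assume "i < length gs" "c i \<noteq> 0"
        then have "gs ! i \<in> Y" "gs ! i \<in> carrier G" using c gs by (auto simp: supp_def)
        then show "\<tau> y * \<tau> (gs ! i) = \<tau> (gs ! i) * \<tau> y"
          using that(2) comm mult.hyps(2) y(2) by metis
      qed (use that gs y in auto)
      have step: "mtrace (\<tau> (s \<otimes> a) * pow_deriv (lincomb_mat d c gs \<tau>) (\<tau> y) (Suc k)) =
          of_nat (Suc k) * mtrace (\<tau> (s \<otimes> (a \<otimes> y)) * lincomb_mat d c gs \<tau> ^\<^sub>m k)"
        if t: "\<And>g. g \<in> carrier G \<Longrightarrow> \<tau> g \<in> carrier_mat d d"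
          "\<And>g h. g \<in> carrier G \<Longrightarrow> h \<in> carrier G \<Longrightarrow> \<tau> (g \<otimes> h) = \<tau> g * \<tau> h" for \<tau>
      proof -
        have pc: "lincomb_mat d c gs \<tau> ^\<^sub>m k \<in> carrier_mat d d" by (simp add: pow_carrier_mat)
        have "\<tau> (s \<otimes> (a \<otimes> y)) = \<tau> (s \<otimes> a) * \<tau> y" using t(2)[OF sa y(2)] ac y by (simp add: m_assoc)
        then have "\<tau> (s \<otimes> a) * pow_deriv (lincomb_mat d c gs \<tau>) (\<tau> y) (Suc k) =
            of_nat (Suc k) \<cdot>\<^sub>m (\<tau> (s \<otimes> (a \<otimes> y)) * lincomb_mat d c gs \<tau> ^\<^sub>m k)"
          using t(1)[OF sa] t(1)[OF y(2)] pc
          by (simp add: pow_deriv_commute[OF lincomb_mat_carrier(1) t(1)[OF y(2)] comm_y[OF t]]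
              mult_smult_distrib[of _ d d _ d] mult_carrier_mat[of _ d d] assoc_mult_mat[of _ d d _ d _ d]
              del: pow_deriv.simps)
        moreover have "dim_row (\<tau> (s \<otimes> (a \<otimes> y))) = d" "dim_col (lincomb_mat d c gs \<tau> ^\<^sub>m k) = d"
          using t(1)[of "s \<otimes> (a \<otimes> y)"] pc ac y by auto
        ultimately show ?thesis
          by (simp add: mtrace_def sum_distrib_left del: pow_deriv.simps index_mult_mat(1))
      qed
      show ?thesis using * step[OF rc rm] step[OF sc sm]
        by (simp del: of_nat_Suc pow_deriv.simps)
    qed
    then show ?case using ac y by simp
  qed
  moreover have "supp (\<lambda>_. 0)" by (simp add: supp_def)
  ultimately have ac: "a \<in> carrier G" and "mtrace (\<rho> (s \<otimes> a) * lincomb_mat d (\<lambda>_. 0) gs \<rho> ^\<^sub>m 0) =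
      mtrace (\<sigma> (s \<otimes> a) * lincomb_mat d (\<lambda>_. 0) gs \<sigma> ^\<^sub>m 0)"
    by blast+
  moreover have "s \<otimes> a \<in> carrier G" using ac s gs by auto
  ultimately show ?thesis using rc[of "s \<otimes> a"] sc[of "s \<otimes> a"]
    by (simp add: right_mult_one_mat[of _ d d])
qed

section \<open>The groups G(r,p,n)\<close>

lemma GL_simps: "(\<otimes>\<^bsub>GL n\<^esub>) = (*)" "\<one>\<^bsub>GL n\<^esub> = 1\<^sub>m n"
  "carrier (GL n) = Units (ring_mat TYPE(complex) n ())"
  by (auto simp: GL_def units_of_def ring_mat_def)

lemma group_GL: "group (GL n)"
proof -
  interpret ring "ring_mat TYPE(complex) n ()" by (rule ring_mat)
  show ?thesis unfolding GL_def by (rule units_group)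
qed

lemma GL_carrier_mat: "A \<in> carrier (GL n) \<Longrightarrow> A \<in> carrier_mat n n"
  by (auto simp: GL_simps Units_def ring_mat_simps)

lemma in_GL_I:
  assumes "A \<in> carrier_mat n n" "B \<in> carrier_mat n n" "A * B = 1\<^sub>m n" "B * A = 1\<^sub>m n"
  shows "A \<in> carrier (GL n)"
  using assms by (auto simp: GL_simps Units_def ring_mat_simps)

lemma complex_rep_imp_mat_rep:
  assumes "group G" "complex_rep G d \<rho>"
  shows "mat_rep G d \<rho>"
proof -
  interpret group_hom G "GL d" \<rho>
    using assms group_GL by (auto simp: complex_rep_def group_hom_def group_hom_axioms_def)
  show ?thesis
    using GL_carrier_mat hom_closed hom_one hom_mult unfolding mat_rep_def GL_simps by blast
qed

text \<open>
  The matrix of \<open>\<sigma>\<close> times the diagonal matrix of \<open>\<omega>\<close>: all elements of \<open>G(r,p,n)\<close> have this form, and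
  products of such matrices can be computed on \<open>\<sigma>\<close> and \<open>\<omega>\<close>.
\<close>
definition mono_mat :: "nat \<Rightarrow> (nat \<Rightarrow> nat) \<Rightarrow> (nat \<Rightarrow> complex) \<Rightarrow> complex mat" where
  "mono_mat n \<sigma> \<omega> = mat n n (\<lambda>(i, j). if i = \<sigma> j then \<omega> j else 0)"

definition admissible :: "nat \<Rightarrow> nat \<Rightarrow> nat \<Rightarrow> (nat \<Rightarrow> complex) \<Rightarrow> bool" where
  "admissible r p n \<omega> \<longleftrightarrow> (\<forall>i<n. \<omega> i ^ r = 1) \<and> (\<Prod>i<n. \<omega> i) ^ (r div p) = 1"

lemma mono_mat_carrier[simp]: "mono_mat n \<sigma> \<omega> \<in> carrier_mat n n"
  by (simp add: mono_mat_def)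

lemma perm_mat_mult_mat_diag: "perm_mat n \<sigma> * mat_diag n \<omega> = mono_mat n \<sigma> \<omega>"
  by (subst mat_diag_mult_right[of _ n]) (auto simp: perm_mat_def mono_mat_def)

lemma perm_mat_eq_mono_mat: "perm_mat n \<sigma> = mono_mat n \<sigma> (\<lambda>_. 1)"
  and mat_diag_eq_mono_mat: "mat_diag n \<omega> = mono_mat n id \<omega>"
  by (auto simp: perm_mat_def mono_mat_def mat_diag_def)

lemma mono_mat_cong: "(\<And>j. j < n \<Longrightarrow> \<omega> j = \<eta> j) \<Longrightarrow> mono_mat n \<sigma> \<omega> = mono_mat n \<sigma> \<eta>"
  by (auto simp: mono_mat_def intro!: eq_matI)

lemma mono_mat_one: "mono_mat n id (\<lambda>_. 1) = 1\<^sub>m n"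
  by (auto simp: mono_mat_def intro!: eq_matI)

lemma mono_mat_mult:
  assumes "\<tau> permutes {..<n}"
  shows "mono_mat n \<sigma> \<omega> * mono_mat n \<tau> \<eta> = mono_mat n (\<sigma> \<circ> \<tau>) (\<lambda>j. \<omega> (\<tau> j) * \<eta> j)"
proof (rule eq_matI)
  fix i j assume "i < dim_row (mono_mat n (\<sigma> \<circ> \<tau>) (\<lambda>j. \<omega> (\<tau> j) * \<eta> j))"
    "j < dim_col (mono_mat n (\<sigma> \<circ> \<tau>) (\<lambda>j. \<omega> (\<tau> j) * \<eta> j))"
  then have ij: "i < n" "j < n" by (auto simp: mono_mat_def)
  have tj: "\<tau> j < n" using permutes_in_image[OF assms, of j] ij by simp
  have "(mono_mat n \<sigma> \<omega> * mono_mat n \<tau> \<eta>) $$ (i, j) =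
      (\<Sum>l<n. mono_mat n \<sigma> \<omega> $$ (i, l) * mono_mat n \<tau> \<eta> $$ (l, j))"
    using ij by (intro index_mult_mat_sum) auto
  also have "\<dots> = (\<Sum>l<n. if l = \<tau> j then (if i = \<sigma> (\<tau> j) then \<omega> (\<tau> j) * \<eta> j else 0) else 0)"
    using ij by (intro sum.cong refl) (auto simp: mono_mat_def)
  finally show "(mono_mat n \<sigma> \<omega> * mono_mat n \<tau> \<eta>) $$ (i, j) =
      mono_mat n (\<sigma> \<circ> \<tau>) (\<lambda>j. \<omega> (\<tau> j) * \<eta> j) $$ (i, j)"
    using ij tj by (simp add: mono_mat_def)
qed (auto simp: mono_mat_def)

lemma admissible_one: "admissible r p n (\<lambda>_. 1)"
  by (simp add: admissible_def)

lemma admissible_permute: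
  assumes "admissible r p n \<omega>" "\<tau> permutes {..<n}"
  shows "admissible r p n (\<lambda>j. \<omega> (\<tau> j))"
proof -
  have "(\<Prod>i<n. \<omega> (\<tau> i)) = (\<Prod>i<n. \<omega> i)"
    using prod.permute[OF assms(2), of \<omega>] by (simp add: comp_def)
  then show ?thesis using assms permutes_in_image[OF assms(2)] by (auto simp: admissible_def)
qed

lemma admissible_mult:
  assumes "admissible r p n \<omega>" "admissible r p n \<eta>"
  shows "admissible r p n (\<lambda>j. \<omega> j * \<eta> j)"
  using assms by (auto simp: admissible_def power_mult_distrib prod.distrib)

lemma admissible_inverse:
  assumes "admissible r p n \<omega>"
  shows "admissible r p n (\<lambda>j. inverse (\<omega> j))"
proof -
  have "(\<Prod>i<n. inverse (\<omega> i)) = inverse (\<Prod>i<n. \<omega> i)"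
    using prod_inversef[of \<omega> "{..<n}"] by (simp add: comp_def)
  then show ?thesis using assms by (auto simp: admissible_def power_inverse)
qed

definition G_set :: "nat \<Rightarrow> nat \<Rightarrow> nat \<Rightarrow> complex mat set" where
  "G_set r p n = {mono_mat n \<sigma> \<omega> | \<sigma> \<omega>. \<sigma> permutes {..<n} \<and> admissible r p n \<omega>}"

lemma A_grp_eq: "A_grp r p n = {mat_diag n \<omega> | \<omega>. admissible r p n \<omega>}"
  by (simp add: A_grp_def admissible_def)

lemma G_grp_simps: "carrier (G_grp r p n) = G_set r p n" "(\<otimes>\<^bsub>G_grp r p n\<^esub>) = (*)"
  "\<one>\<^bsub>G_grp r p n\<^esub> = 1\<^sub>m n"
proof -
  show "carrier (G_grp r p n) = G_set r p n"
    by (fastforce simp: G_grp_def set_mult_def Sigma_grp_def A_grp_eq G_set_def GL_simps perm_mat_mult_mat_diag)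
qed (auto simp: G_grp_def GL_simps)

lemma mono_mat_inverse:
  assumes "\<sigma> permutes {..<n}" "\<And>j. j < n \<Longrightarrow> \<omega> j \<noteq> 0"
  defines "\<omega>' \<equiv> \<lambda>j. inverse (\<omega> (inv_into UNIV \<sigma> j))"
  shows "mono_mat n \<sigma> \<omega> * mono_mat n (inv_into UNIV \<sigma>) \<omega>' = 1\<^sub>m n"
    "mono_mat n (inv_into UNIV \<sigma>) \<omega>' * mono_mat n \<sigma> \<omega> = 1\<^sub>m n"
proof -
  have i: "inv_into UNIV \<sigma> permutes {..<n}" using permutes_inv[OF assms(1)] .
  have lt: "inv_into UNIV \<sigma> j < n" if "j < n" for j using permutes_in_image[OF i, of j] that by simp
  show "mono_mat n \<sigma> \<omega> * mono_mat n (inv_into UNIV \<sigma>) \<omega>' = 1\<^sub>m n"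
    unfolding mono_mat_mult[OF i] permutes_inv_o(1)[OF assms(1)] \<omega>'_def mono_mat_one[symmetric]
    using assms(2) lt by (intro mono_mat_cong) simp
  show "mono_mat n (inv_into UNIV \<sigma>) \<omega>' * mono_mat n \<sigma> \<omega> = 1\<^sub>m n"
    unfolding mono_mat_mult[OF assms(1)] permutes_inv_o(2)[OF assms(1)] \<omega>'_def mono_mat_one[symmetric]
    using assms(2) by (intro mono_mat_cong) (simp add: permutes_inverses[OF assms(1)])
qed

lemma admissible_nonzero: "admissible r p n \<omega> \<Longrightarrow> r > 0 \<Longrightarrow> j < n \<Longrightarrow> \<omega> j \<noteq> 0"
  by (auto simp: admissible_def) (metis power_0_left zero_neq_one not_gr0)

lemma subgroup_G_set:
  assumes "r > 0"
  shows "subgroup (G_set r p n) (GL n)"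
proof -
  have inv_ex: "\<exists>B\<in>G_set r p n. A * B = 1\<^sub>m n \<and> B * A = 1\<^sub>m n" if A_in: "A \<in> G_set r p n" for A
  proof -
    obtain \<sigma> \<omega> where A: "A = mono_mat n \<sigma> \<omega>" "\<sigma> permutes {..<n}" "admissible r p n \<omega>"
      using A_in by (auto simp: G_set_def)
    note inv = mono_mat_inverse[where \<omega> = \<omega>, OF A(2) admissible_nonzero[OF A(3) assms]]
    have "mono_mat n (inv_into UNIV \<sigma>) (\<lambda>j. inverse (\<omega> (inv_into UNIV \<sigma> j))) \<in> G_set r p n"
      unfolding G_set_def
      using permutes_inv[OF A(2)] admissible_permute[OF admissible_inverse[OF A(3)] permutes_inv[OF A(2)]] by blast
    then show ?thesis using inv A(1) by blast
  qed
  have carr: "A \<in> carrier_mat n n" if "A \<in> G_set r p n" for A using that by (auto simp: G_set_def)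
  have GL: "A \<in> carrier (GL n)" if "A \<in> G_set r p n" for A
    using inv_ex[OF that] carr[OF that] carr in_GL_I by metis
  interpret group "GL n" by (rule group_GL)
  show ?thesis
  proof
    show "G_set r p n \<subseteq> carrier (GL n)" using GL by blast
    show "\<one>\<^bsub>GL n\<^esub> \<in> G_set r p n"
      unfolding GL_simps G_set_def mono_mat_one[symmetric] using permutes_id admissible_one by blast
    fix A B assume A: "A \<in> G_set r p n" and B: "B \<in> G_set r p n"
    obtain \<sigma> \<omega> where A': "A = mono_mat n \<sigma> \<omega>" "\<sigma> permutes {..<n}" "admissible r p n \<omega>"
      using A by (auto simp: G_set_def)
    obtain \<tau> \<eta> where B': "B = mono_mat n \<tau> \<eta>" "\<tau> permutes {..<n}" "admissible r p n \<eta>"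
      using B by (auto simp: G_set_def)
    show "A \<otimes>\<^bsub>GL n\<^esub> B \<in> G_set r p n"
      unfolding GL_simps A'(1) B'(1) mono_mat_mult[OF B'(2)] G_set_def
      using permutes_compose[OF B'(2) A'(2)] admissible_mult[OF admissible_permute[OF A'(3) B'(2)] B'(3)] by blast
  next
    fix A assume A: "A \<in> G_set r p n"
    obtain B where B: "B \<in> G_set r p n" "A * B = 1\<^sub>m n" "B * A = 1\<^sub>m n" using inv_ex[OF A] by blast
    have "inv\<^bsub>GL n\<^esub> A = B"
      using B GL[OF A] GL[OF B(1)] by (intro inv_equality) (auto simp: GL_simps)
    then show "inv\<^bsub>GL n\<^esub> A \<in> G_set r p n" using B by simp
  qed
qed

lemma group_G_grp:
  assumes "r > 0"
  shows "group (G_grp r p n)"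
proof -
  have "G_grp r p n = (GL n)\<lparr>carrier := G_set r p n\<rparr>"
    using G_grp_simps(1)[of r p n] by (simp add: G_grp_def)
  then show ?thesis using subgroup.subgroup_is_group[OF subgroup_G_set[OF assms] group_GL] by simp
qed

lemma finite_G_set:
  assumes "r > 0"
  shows "finite (G_set r p n)"
proof -
  let ?R = "{z :: complex. z ^ r = 1}"
  have "G_set r p n \<subseteq> (\<lambda>(\<sigma>, \<omega>). mono_mat n \<sigma> \<omega>) ` ({\<sigma>. \<sigma> permutes {..<n}} \<times> ({..<n} \<rightarrow>\<^sub>E ?R))"
  proof
    fix A assume "A \<in> G_set r p n"
    then obtain \<sigma> \<omega> where A: "A = mono_mat n \<sigma> \<omega>" "\<sigma> permutes {..<n}" "admissible r p n \<omega>"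
      by (auto simp: G_set_def)
    have "A = mono_mat n \<sigma> (restrict \<omega> {..<n})" unfolding A(1) by (rule mono_mat_cong) simp
    moreover have "restrict \<omega> {..<n} \<in> {..<n} \<rightarrow>\<^sub>E ?R" using A(3) by (auto simp: admissible_def)
    ultimately show "A \<in> (\<lambda>(\<sigma>, \<omega>). mono_mat n \<sigma> \<omega>) ` ({\<sigma>. \<sigma> permutes {..<n}} \<times> ({..<n} \<rightarrow>\<^sub>E ?R))"
      using A(2) by blast
  qed
  moreover have "finite ?R" using assms by (intro finite_roots_unity) simp
  ultimately show ?thesis
    by (elim finite_subset) (intro finite_imageI finite_cartesian_product finite_permutations finite_PiE finite_lessThan; simp)
qed

lemma Sigma_grp_subset: "Sigma_grp n \<subseteq> G_set r p n"
  using admissible_one[of r p n] unfolding Sigma_grp_def G_set_def perm_mat_eq_mono_mat by blast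

lemma A_grp_subset: "A_grp r p n \<subseteq> G_set r p n"
  using permutes_id[of "{..<n}"] unfolding A_grp_eq G_set_def mat_diag_eq_mono_mat by blast

definition zeta :: "nat \<Rightarrow> complex" where "zeta r = cis (2 * pi / real r)"

lemma zeta_pow: "zeta r ^ k = cis (2 * pi * real k / real r)"
  by (simp add: zeta_def DeMoivre mult_ac)

lemma zeta_pow_self: "r > 0 \<Longrightarrow> zeta r ^ r = 1"
  by (simp add: zeta_pow)

lemma root_of_unity_eq_zeta_pow:
  assumes "r > 0" "z ^ r = 1"
  obtains k where "z = zeta r ^ k"
proof -
  have "z \<in> (\<lambda>k. cis (2 * pi * real k / real r)) ` {..<r}"
    using bij_betw_roots_unity[OF assms(1)] assms(2) by (simp add: bij_betw_def)
  then show thesis using that by (auto simp: zeta_pow)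
qed

lemma zeta_pow_eq_1_imp_dvd:
  assumes "r > 0" "zeta r ^ k = 1"
  shows "r dvd k"
proof -
  have "k = r * (k div r) + k mod r" by simp
  then have "zeta r ^ k = (zeta r ^ r) ^ (k div r) * zeta r ^ (k mod r)"
    by (metis power_add power_mult)
  then have eq: "zeta r ^ (k mod r) = zeta r ^ 0"
    using assms zeta_pow_self by simp
  have inj: "inj_on (\<lambda>k. zeta r ^ k) {..<r}"
    using bij_betw_roots_unity[OF assms(1)] by (simp add: bij_betw_def zeta_pow)
  have "k mod r = 0" using assms(1) by (intro inj_onD[OF inj eq]) auto
  then show ?thesis by auto
qed

lemma y_elt_first: "y_elt r p n 1 = mat_diag n (\<lambda>k. if k = 0 then zeta r ^ p else 1)"
proof -
  have "exp (2 * of_nat p * of_real pi * \<i> / of_nat r) = zeta r ^ p"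
    by (simp add: zeta_pow cis_conv_exp mult_ac)
  then show ?thesis by (simp add: y_elt_def cong: if_cong)
qed

lemma y_elt_later:
  "y_elt r p n (Suc (Suc k)) = mat_diag n (\<lambda>i. if i = k then inverse (zeta r) else if i = Suc k then zeta r else 1)"
proof -
  have "exp (- (2 * of_real pi * \<i> / of_nat r)) = inverse (zeta r)" "exp (2 * of_real pi * \<i> / of_nat r) = zeta r"
    by (simp_all add: zeta_def cis_conv_exp mult_ac exp_minus)
  then show ?thesis by (simp add: y_elt_def cong: if_cong)
qed

lemma y_elt_in_A_grp:
  assumes "r > 0" "p dvd r" "1 \<le> j" "j \<le> n"
  shows "y_elt r p n j \<in> A_grp r p n"
proof (cases "j = 1")
  case True
  have "(zeta r ^ p) ^ (r div p) = 1" using assms zeta_pow_self by (simp flip: power_mult)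
  moreover have "(\<Prod>i<n. if i = 0 then zeta r ^ p else 1) = zeta r ^ p" using assms by simp
  moreover have "(zeta r ^ p) ^ r = 1" using zeta_pow_self[OF assms(1)] by (metis mult.commute power_mult power_one)
  ultimately show ?thesis unfolding True y_elt_first A_grp_eq admissible_def
    by (auto intro!: exI[of _ "\<lambda>k. if k = 0 then zeta r ^ p else 1"])
next
  case False
  then obtain k where k: "j = Suc (Suc k)" using assms(3) by (metis One_nat_def Suc_le_D not0_implies_Suc)
  have z: "zeta r \<noteq> 0" by (simp add: zeta_def)
  have "(\<Prod>i<n. if i = k then inverse (zeta r) else if i = Suc k then zeta r else 1) =
     (\<Prod>i<n. (if i = k then inverse (zeta r) else 1) * (if i = Suc k then zeta r else 1))"
    by (intro prod.cong) auto
  also have "\<dots> = 1" using k assms(4) z by (simp add: prod.distrib)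
  finally have "admissible r p n (\<lambda>i. if i = k then inverse (zeta r) else if i = Suc k then zeta r else 1)"
    using zeta_pow_self[OF assms(1)] by (simp add: admissible_def power_inverse)
  then show ?thesis unfolding k y_elt_later A_grp_eq by blast
qed

lemma gen_monoid_diag_pow:
  assumes "mat_diag n \<omega> \<in> gen_monoid (G_grp r p n) Y" "mat_diag n \<eta> \<in> Y"
  shows "mat_diag n (\<lambda>i. \<omega> i * \<eta> i ^ t) \<in> gen_monoid (G_grp r p n) Y"
proof (induction t)
  case (Suc t)
  then have "mat_diag n (\<lambda>i. \<omega> i * \<eta> i ^ t) \<otimes>\<^bsub>G_grp r p n\<^esub> mat_diag n \<eta> \<in> gen_monoid (G_grp r p n) Y"
    by (intro gen_monoid.mult assms)
  then show ?case by (simp add: G_grp_simps mult_ac)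
qed (use assms in simp)

lemma mat_diag_cong: "(\<And>i. i < n \<Longrightarrow> \<omega> i = \<eta> i) \<Longrightarrow> mat_diag n \<omega> = mat_diag n \<eta>"
  by (auto simp: mat_diag_def intro!: eq_matI)

text \<open>
  The exponent vectors of \<open>y\<^sub>1\<close> and of \<open>y\<^sub>j\<close> for \<open>j \<ge> 2\<close> are \<open>p e\<^sub>1\<close> and \<open>e\<^sub>j - e\<^bsub>j-1\<^esub>\<close>. Splitting
  off a power of \<open>y\<^sub>j\<close> moves the last exponent one position to the left without changing the
  sum of the exponents, until everything sits in the first position, where the sum is a multiple of
  \<open>p\<close>. All powers used are natural numbers.
\<close>
lemma diag_zeta_in_gen_monoid:
  assumes "k < n" "p dvd (\<Sum>i<n. c i)" "\<And>i. k < i \<Longrightarrow> c i = 0"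
  shows "mat_diag n (\<lambda>i. zeta r ^ c i) \<in> gen_monoid (G_grp r p n) (y_elt r p n ` {1..n})"
  using assms
proof (induction k arbitrary: c)
  case 0
  have "(\<Sum>i<n. c i) = (\<Sum>i<n. if i = 0 then c 0 else 0)" using 0 by (intro sum.cong) auto
  then obtain t where t: "c 0 = p * t" using 0 by auto
  have "mat_diag n (\<lambda>i. 1) \<in> gen_monoid (G_grp r p n) (y_elt r p n ` {1..n})"
    using gen_monoid.one[of "G_grp r p n"] by (simp add: G_grp_simps)
  moreover have "mat_diag n (\<lambda>k. if k = 0 then zeta r ^ p else 1) \<in> y_elt r p n ` {1..n}"
    using 0 by (intro image_eqI[where x = 1]) (auto simp only: y_elt_first atLeastAtMost_iff)
  ultimately have "mat_diag n (\<lambda>i. 1 * (if i = 0 then zeta r ^ p else 1) ^ t) \<in>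
      gen_monoid (G_grp r p n) (y_elt r p n ` {1..n})"
    by (rule gen_monoid_diag_pow)
  moreover have "mat_diag n (\<lambda>i. 1 * (if i = 0 then zeta r ^ p else 1) ^ t) = mat_diag n (\<lambda>i. zeta r ^ c i)"
    using 0 t by (intro mat_diag_cong) (auto simp: power_mult)
  ultimately show ?case by simp
next
  case (Suc k)
  define c' where "c' = c(Suc k := 0, k := c k + c (Suc k))"
  have "(\<Sum>i<n. c' i + (if i = Suc k then c (Suc k) else 0)) = (\<Sum>i<n. c i + (if i = k then c (Suc k) else 0))"
    by (intro sum.cong) (auto simp: c'_def)
  then have "(\<Sum>i<n. c' i) = (\<Sum>i<n. c i)" using Suc.prems(1) by (simp add: sum.distrib)
  then have "mat_diag n (\<lambda>i. zeta r ^ c' i) \<in> gen_monoid (G_grp r p n) (y_elt r p n ` {1..n})"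
    using Suc.prems by (intro Suc.IH) (auto simp: c'_def)
  moreover have "mat_diag n (\<lambda>i. if i = k then inverse (zeta r) else if i = Suc k then zeta r else 1) \<in> y_elt r p n ` {1..n}"
    using Suc.prems(1) by (intro image_eqI[where x = "Suc (Suc k)"]) (auto simp: y_elt_later)
  ultimately have "mat_diag n (\<lambda>i. zeta r ^ c' i * (if i = k then inverse (zeta r) else if i = Suc k then zeta r else 1) ^ c (Suc k))
      \<in> gen_monoid (G_grp r p n) (y_elt r p n ` {1..n})"
    by (rule gen_monoid_diag_pow)
  moreover have "zeta r \<noteq> 0" by (simp add: zeta_def)
  then have "mat_diag n (\<lambda>i. zeta r ^ c' i * (if i = k then inverse (zeta r) else if i = Suc k then zeta r else 1) ^ c (Suc k)) =
      mat_diag n (\<lambda>i. zeta r ^ c i)"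
    by (intro mat_diag_cong) (auto simp: c'_def power_add power_inverse)
  ultimately show ?case by simp
qed

text \<open>
  Write the diagonal entries as powers of the primitive root \<open>zeta r\<close>; the condition on the product
  of the entries says that \<open>p\<close> divides the sum of the exponents.
\<close>
lemma A_grp_generated:
  assumes "r > 0" "p > 0" "n > 0" "p dvd r" "a \<in> A_grp r p n"
  shows "a \<in> gen_monoid (G_grp r p n) (y_elt r p n ` {1..n})"
proof -
  obtain \<omega> where a: "a = mat_diag n \<omega>" and \<omega>: "\<And>i. i < n \<Longrightarrow> \<omega> i ^ r = 1" "(\<Prod>i<n. \<omega> i) ^ (r div p) = 1"
    using assms(5) by (auto simp: A_grp_def)
  have "\<forall>i. \<exists>k. i < n \<longrightarrow> \<omega> i = zeta r ^ k"
    using root_of_unity_eq_zeta_pow[OF assms(1)] \<omega>(1) by metis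
  then obtain c0 where c0: "\<And>i. i < n \<Longrightarrow> \<omega> i = zeta r ^ c0 i" by metis
  define c where "c i = (if i < n then c0 i else 0)" for i
  have c: "\<omega> i = zeta r ^ c i" if "i < n" for i using c0 that by (simp add: c_def)
  have "(\<Prod>i<n. \<omega> i) = zeta r ^ (\<Sum>i<n. c i)" using c by (simp add: power_sum)
  then have "zeta r ^ ((\<Sum>i<n. c i) * (r div p)) = 1" using \<omega>(2) by (simp add: power_mult)
  then have "p * (r div p) dvd (\<Sum>i<n. c i) * (r div p)"
    using zeta_pow_eq_1_imp_dvd[OF assms(1)] assms(4) by simp
  moreover have "r div p \<noteq> 0" using assms by (auto elim!: dvdE)
  ultimately have "p dvd (\<Sum>i<n. c i)" by simp
  then have "mat_diag n (\<lambda>i. zeta r ^ c i) \<in> gen_monoid (G_grp r p n) (y_elt r p n ` {1..n})"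
    using assms(3) by (intro diag_zeta_in_gen_monoid[of "n - 1"]) (auto simp: c_def)
  then show ?thesis using mat_diag_cong[of n \<omega>] c a by metis
qed

text \<open>
  Conjugacy is stated as \<open>g h = h k\<close>, the form in which \<open>conj_to_representative\<close> provides it.
\<close>
lemma mtrace_conj:
  assumes "mat_rep G d \<rho>" "group G" "g \<in> carrier G" "h \<in> carrier G" "k \<in> carrier G" "g \<otimes>\<^bsub>G\<^esub> h = h \<otimes>\<^bsub>G\<^esub> k"
  shows "mtrace (\<rho> g) = mtrace (\<rho> k)"
proof -
  interpret group G by fact
  have c: "\<And>x. x \<in> carrier G \<Longrightarrow> \<rho> x \<in> carrier_mat d d"
    and m: "\<And>x y. x \<in> carrier G \<Longrightarrow> y \<in> carrier G \<Longrightarrow> \<rho> (x \<otimes>\<^bsub>G\<^esub> y) = \<rho> x * \<rho> y"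
    using assms(1) by (auto simp: mat_rep_def)
  have "g = (h \<otimes>\<^bsub>G\<^esub> k) \<otimes>\<^bsub>G\<^esub> inv\<^bsub>G\<^esub> h" using assms by (metis inv_solve_right m_closed)
  then have "mtrace (\<rho> g) = mtrace (\<rho> (h \<otimes>\<^bsub>G\<^esub> k) * \<rho> (inv\<^bsub>G\<^esub> h))" using assms m by simp
  also have "\<dots> = mtrace (\<rho> (inv\<^bsub>G\<^esub> h) * \<rho> (h \<otimes>\<^bsub>G\<^esub> k))"
    using assms c by (intro mtrace_mult_comm[of _ d d]) auto
  also have "\<dots> = mtrace (\<rho> (inv\<^bsub>G\<^esub> h \<otimes>\<^bsub>G\<^esub> (h \<otimes>\<^bsub>G\<^esub> k)))" using assms m by simp
  also have "inv\<^bsub>G\<^esub> h \<otimes>\<^bsub>G\<^esub> (h \<otimes>\<^bsub>G\<^esub> k) = k" using assms by (simp flip: m_assoc)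
  finally show ?thesis .
qed

text \<open>
  If \<open>\<sigma> = h s h\<inverse>\<close>, then \<open>h\<inverse> (\<sigma> D) h = s (h\<inverse> D h)\<close>, and conjugation by a permutation matrix
  only permutes the entries of the diagonal matrix \<open>D\<close>.
\<close>
lemma conj_to_representative:
  assumes r: "r > 0" and S: "represents_conj_classes n S" and g: "g \<in> G_set r p n"
  obtains h s a where "h \<in> Sigma_grp n" "s \<in> S" "a \<in> A_grp r p n" "g * h = h * (s * a)"
proof -
  obtain \<sigma> \<omega> where g': "g = perm_mat n \<sigma> * mat_diag n \<omega>" "\<sigma> permutes {..<n}" "admissible r p n \<omega>"
    using g by (auto simp: G_set_def perm_mat_mult_mat_diag)
  have "perm_mat n \<sigma> \<in> Sigma_grp n" using g' by (auto simp: Sigma_grp_def)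
  then obtain s h where sh: "s \<in> S" "h \<in> Sigma_grp n" "perm_mat n \<sigma> = h * s * inv\<^bsub>GL n\<^esub> h"
    using S unfolding represents_conj_classes_def GL_simps by blast
  obtain \<tau> where \<tau>: "h = perm_mat n \<tau>" "\<tau> permutes {..<n}" using sh(2) by (auto simp: Sigma_grp_def)
  define a where "a = mat_diag n (\<lambda>j. \<omega> (\<tau> j))"
  have "a \<in> A_grp r p n" using admissible_permute[OF g'(3) \<tau>(2)] by (auto simp: A_grp_eq a_def)
  have Dh: "mat_diag n \<omega> * h = h * a"
    unfolding \<tau>(1) a_def perm_mat_mult_mat_diag
    unfolding mat_diag_eq_mono_mat perm_mat_eq_mono_mat mono_mat_mult[OF \<tau>(2)] by simp
  interpret group "GL n" by (rule group_GL)
  have sub: "Sigma_grp n \<subseteq> carrier (GL n)"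
    using Sigma_grp_subset subgroup.subset[OF subgroup_G_set[OF r]] by blast
  have hs: "h \<in> carrier (GL n)" "s \<in> carrier (GL n)"
    using sh sub S by (auto simp: represents_conj_classes_def)
  note c = hs[THEN GL_carrier_mat] GL_carrier_mat[OF inv_closed[OF hs(1)]]
  have ac: "a \<in> carrier_mat n n" "mat_diag n \<omega> \<in> carrier_mat n n" by (auto simp: a_def)
  have hi: "inv\<^bsub>GL n\<^esub> h * h = 1\<^sub>m n" using l_inv[OF hs(1)] by (simp add: GL_simps)
  have "g * h = h * s * inv\<^bsub>GL n\<^esub> h * (mat_diag n \<omega> * h)"
    unfolding g'(1) sh(3) using c ac by (simp add: assoc_mult_mat[of _ n n _ n _ n] mult_carrier_mat[of _ n n])
  also have "\<dots> = h * (s * ((inv\<^bsub>GL n\<^esub> h * h) * a))"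
    unfolding Dh using c ac by (simp add: assoc_mult_mat[of _ n n _ n _ n] mult_carrier_mat[of _ n n])
  also have "\<dots> = h * (s * a)" unfolding hi using ac by simp
  finally show thesis using that sh \<open>a \<in> A_grp r p n\<close> by blast
qed

theorem theorem4p10:
  fixes r p n d1 d2 :: nat
    and S1 S2 :: "complex mat set"
    and gs :: "complex mat list"
    and \<rho>1 \<rho>2 :: "complex mat \<Rightarrow> complex mat"
  assumes "r > 0" and "p > 0" and "n > 0" and "p dvd r"
    and "represents_conj_classes n S1"
    and "S2 = y_elt r p n ` {1..n}"
    and "set gs = S1 \<union> S2 \<union> set_inv\<^bsub>GL n\<^esub> S2"
    and "complex_rep (G_grp r p n) d1 \<rho>1"
    and "complex_rep (G_grp r p n) d2 \<rho>2"
  shows "rep_charpoly gs d1 \<rho>1 = rep_charpoly gs d2 \<rho>2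
         \<longleftrightarrow> rep_equiv (G_grp r p n) d1 \<rho>1 d2 \<rho>2"
proof -
  let ?G = "G_grp r p n"
  interpret group ?G using group_G_grp[OF assms(1)] .
  have rep1: "mat_rep ?G d1 \<rho>1" and rep2: "mat_rep ?G d2 \<rho>2"
    using complex_rep_imp_mat_rep is_group assms(8,9) by auto
  have S2: "S2 \<subseteq> A_grp r p n" using y_elt_in_A_grp[OF assms(1,4)] assms(6) by auto
  have gs: "set gs \<subseteq> carrier ?G"
  proof -
    have "S1 \<subseteq> G_set r p n"
      using assms(5) Sigma_grp_subset[of n r p] by (auto simp: represents_conj_classes_def)
    moreover have "S2 \<subseteq> G_set r p n" using S2 A_grp_subset[of r p n] by blast
    moreover from this have "set_inv\<^bsub>GL n\<^esub> S2 \<subseteq> G_set r p n"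
      using subgroup.m_inv_closed[OF subgroup_G_set[OF assms(1), of p n]] by (auto simp: SET_INV_def)
    ultimately show ?thesis by (simp add: assms(7) G_grp_simps)
  qed
  have c1: "\<And>g. g \<in> set gs \<Longrightarrow> \<rho>1 g \<in> carrier_mat d1 d1" and c2: "\<And>g. g \<in> set gs \<Longrightarrow> \<rho>2 g \<in> carrier_mat d2 d2"
    using rep1 rep2 gs by (auto simp: mat_rep_def)
  show ?thesis
  proof
    assume eq: "rep_charpoly gs d1 \<rho>1 = rep_charpoly gs d2 \<rho>2"
    have d: "d2 = d1" using rep_charpoly_eq_imp_trace_pow_eq(1)[OF c1 c2 eq] by simp
    note tr = rep_charpoly_eq_imp_trace_pow_eq(2)[OF c1 c2 eq, unfolded d]
    note rep2 = rep2[unfolded d]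
    have comm: "y \<otimes>\<^bsub>?G\<^esub> z = z \<otimes>\<^bsub>?G\<^esub> y" if yz: "y \<in> S2" "z \<in> S2" for y z
    proof -
      obtain \<omega> \<eta> where "y = mat_diag n \<omega>" "z = mat_diag n \<eta>"
        using yz S2 unfolding A_grp_def by blast
      then show ?thesis by (simp add: G_grp_simps mult.commute)
    qed
    have char: "mtrace (\<rho>1 g) = mtrace (\<rho>2 g)" if g: "g \<in> carrier ?G" for g
    proof -
      obtain h s a where hsa: "h \<in> Sigma_grp n" "s \<in> S1" "a \<in> A_grp r p n" "g * h = h * (s * a)"
        using conj_to_representative[OF assms(1,5)] g unfolding G_grp_simps by blast
      have in_G: "h \<in> carrier ?G" "s \<in> carrier ?G" "a \<in> carrier ?G"
        using hsa gs assms(7) Sigma_grp_subset[of n r p] A_grp_subset[of r p n] by (auto simp: G_grp_simps)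
      have conj: "g \<otimes>\<^bsub>?G\<^esub> h = h \<otimes>\<^bsub>?G\<^esub> (s \<otimes>\<^bsub>?G\<^esub> a)" using hsa(4) by (simp add: G_grp_simps)
      have "a \<in> gen_monoid ?G S2"
        using A_grp_generated[OF assms(1-4) hsa(3)] assms(6) by simp
      then have "mtrace (\<rho>1 (s \<otimes>\<^bsub>?G\<^esub> a)) = mtrace (\<rho>2 (s \<otimes>\<^bsub>?G\<^esub> a))"
        using rep1 rep2 gs tr comm hsa(2) assms(7)
        by (intro trace_pow_eq_imp_trace_eq[OF is_monoid, of gs \<rho>1 d1 \<rho>2 S2]) (auto simp: mat_rep_def)
      then show ?thesis
        using mtrace_conj[OF rep1 is_group g in_G(1) _ conj] mtrace_conj[OF rep2 is_group g in_G(1) _ conj] in_G by simp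
    qed
    interpret two_reps ?G d1 \<rho>1 \<rho>2
      using finite_G_set[OF assms(1)] rep1 rep2 by unfold_locales (auto simp: G_grp_simps)
    obtain P Q where PQ: "P \<in> carrier_mat d1 d1" "Q \<in> carrier_mat d1 d1" "P * Q = 1\<^sub>m d1" "Q * P = 1\<^sub>m d1"
      "\<And>g. g \<in> carrier ?G \<Longrightarrow> P * \<rho>1 g = \<rho>2 g * P"
      using equal_characters_imp_equivalent[OF char] by blast
    have "invertible_mat P" using PQ(1-4) by (auto simp: invertible_mat_def inverts_mat_def)
    then show "rep_equiv ?G d1 \<rho>1 d2 \<rho>2" using PQ by (auto simp: rep_equiv_def d)
  next
    assume "rep_equiv ?G d1 \<rho>1 d2 \<rho>2"
    then obtain P where P: "P \<in> carrier_mat d2 d1" "invertible_mat P"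
      "\<And>g. g \<in> carrier ?G \<Longrightarrow> P * \<rho>1 g = \<rho>2 g * P" by (auto simp: rep_equiv_def)
    have d: "d2 = d1" using P by (auto simp: invertible_mat_def)
    obtain B where B: "P * B = 1\<^sub>m d1" "B * P = 1\<^sub>m (dim_row B)"
      using P(1,2) by (auto simp: invertible_mat_def inverts_mat_def d)
    have "B \<in> carrier_mat d1 d1"
      using arg_cong[OF B(1), of dim_col] arg_cong[OF B(2), of dim_col] P(1) by (auto simp: d)
    then have "det P \<noteq> 0" using det_mult[of P d1 B] B(1) P(1) by (auto simp: d)
    then show "rep_charpoly gs d1 \<rho>1 = rep_charpoly gs d2 \<rho>2"
      using rep_charpoly_similar[of gs \<rho>1 d1 \<rho>2 P] c1 c2 P gs by (auto simp: d)
  qed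
qed

end
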